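(* Let $(\Lambda,\eta)$, $\Lambda:\Sigma\to S^3$, be an isothermic surface in the $3$-sphere and let $Z\subset\Sigma$ be the (discrete) zero-set of $\eta$. Let $r(t)=\sum_{i\le 0}r_it^i$ be a formal Laurent series with real coefficients and $r_0>0$. Then there is a formal conserved quantity $p(t)$, unique up to sign, defined on $\Sigma\setminus Z$ with $\bigl(p(t),p(t)\bigr)=r(t)$.
   Context: Everything is smooth. $\mathbb{R}^{4,1}$ is the Lorentzian vector space with inner product $(\cdot,\cdot)$ of signature $(4,1)$, $\mathcal{L}$ is its light-cone (non-zero null vectors), and $S^3$ is identified, as a conformal manifold, with $\mathbb{P}(\mathcal{L})$, whose conformal class consists of the metrics $g_\sigma(X,Y)=(\mathrm{d}\sigma(X),\mathrm{d}\sigma(Y))$ for $\sigma$ never-zero sections of $\mathcal{L}\to\mathbb{P}(\mathcal{L})$. $\Sigma$ is a (connected) Riemann surface and $\Lambda:\Sigma\to S^3\cong\mathbb{P}(\mathcal{L})$ is a conformal immersion, viewed as a null line subbundle of the trivial bundle $\underline{\mathbb{R}}^{4,1}=\Sigma\times\mathbb{R}^{4,1}$; $\mathrm{d}$ denotes flat differentiation. Identify $\bigwedge^2\mathbb{R}^{4,1}\cong o(\mathbb{R}^{4,1})$ via $(u\wedge v)w=(u,w)v-(v,w)u$. An isothermic surface $(\Lambda,\eta)$ is such a $\Lambda$ together with a non-zero (not identically zero) closed $1$-form $\eta\in\Omega^1\otimes o(\mathbb{R}^{4,1})$ on $\Sigma$ taking values in $\Lambda\wedge\Lambda^\perp$.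 The zero-set of $\eta$ is discrete. A formal conserved quantity of $(\Lambda,\eta)$ (on an open set) is a formal Laurent series $p(t)=\sum_{i\le 0}p_it^i$ whose coefficients $p_i$ are sections of $\underline{\mathbb{R}}^{4,1}$ over that open set, with $p_0\neq 0$, such that $(\mathrm{d}+t\eta)p(t)$ is the zero series (equivalently $\eta p_0=0$ and $\mathrm{d}p_i+\eta p_{i-1}=0$ for all $i\le 0$). The inner product of series is $\bigl(p(t),p(t)\bigr)=\sum_{k\le 0}\bigl(\sum_{i,j\le 0,\ i+j=k}(p_i,p_j)\bigr)t^k$. *)

theory Defs
  imports "HOL-Analysis.Analysis"
begin

section \<open>Lorentzian space\<close>

type_synonym R41 = "(real ^ 4) \<times> real"

definition lorentz :: "R41 \<Rightarrow> R41 \<Rightarrow> real" where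
  "lorentz u v = fst u \<bullet> fst v - snd u * snd v"

definition light_cone :: "R41 set" where
  "light_cone = {v. v \<noteq> 0 \<and> lorentz v v = 0}"

definition wedge :: "R41 \<Rightarrow> R41 \<Rightarrow> R41 \<Rightarrow>\<^sub>L R41" where
  "wedge u v = Blinfun (\<lambda>w. lorentz u w *\<^sub>R v - lorentz v w *\<^sub>R u)"

lemma bounded_linear_lorentz: "bounded_linear (lorentz u)"
  unfolding lorentz_def
  by (intro bounded_linear_sub bounded_linear_inner_right_comp bounded_linear_const_mult
      bounded_linear_fst bounded_linear_snd)

lemma wedge_apply:
  "blinfun_apply (wedge u v) w = lorentz u w *\<^sub>R v - lorentz v w *\<^sub>R u"
  unfolding wedge_def
  by (subst bounded_linear_Blinfun_apply)
    (auto intro!: bounded_linear_sub bounded_linear_scaleR_left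
      bounded_linear_compose[OF bounded_linear_scaleR_left bounded_linear_lorentz])

lemma lorentz_wedge_skew:
  "lorentz (blinfun_apply (wedge u v) x) y = - lorentz x (blinfun_apply (wedge u v) y)"
  by (simp add: wedge_apply lorentz_def inner_simps inner_commute algebra_simps)

section \<open>Smooth functions on open sets\<close>

text \<open>For open \<open>S\<close> in a finite-dimensional space \<open>C_k_on k S f\<close> says that \<open>f\<close> is of class
  \<open>C\<^sup>k\<close> on \<open>S\<close>; recursing through directional derivatives keeps the codomain fixed.\<close>

primrec C_k_on :: "nat \<Rightarrow> 'a::real_normed_vector set \<Rightarrow> ('a \<Rightarrow> 'b::real_normed_vector) \<Rightarrow> bool" where
  "C_k_on 0 S f \<longleftrightarrow> continuous_on S f"
| "C_k_on (Suc k) S f \<longleftrightarrow>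
     (\<forall>x\<in>S. f differentiable (at x)) \<and>
     (\<forall>v. C_k_on k S (\<lambda>x. frechet_derivative f (at x) v))"

definition smooth_on :: "'a::real_normed_vector set \<Rightarrow> ('a \<Rightarrow> 'b::real_normed_vector) \<Rightarrow> bool" where
  "smooth_on S f \<longleftrightarrow> (\<forall>k. C_k_on k S f)"

section \<open>Riemann surfaces\<close>

text \<open>A chart is its domain together with the coordinate map, which is only meaningful on the
  domain. The surface is the whole type \<open>'a\<close>.\<close>

type_synonym 'a chart = "'a set \<times> ('a \<Rightarrow> complex)"

definition chart_image :: "'a chart \<Rightarrow> 'a set \<Rightarrow> complex set" where
  "chart_image c W = snd c ` (fst c \<inter> W)"

definition chart_inv :: "'a chart \<Rightarrow> complex \<Rightarrow> 'a" where
  "chart_inv c = inv_into (fst c) (snd c)"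

definition riemann_surface :: "('a::t2_space) chart set \<Rightarrow> bool" where
  "riemann_surface A \<longleftrightarrow>
     connected (UNIV :: 'a set) \<and>
     (\<Union>c\<in>A. fst c) = UNIV \<and>
     (\<forall>c\<in>A. open (fst c) \<and> open (snd c ` fst c) \<and>
        homeomorphism (fst c) (snd c ` fst c) (snd c) (chart_inv c)) \<and>
     (\<forall>c\<in>A. \<forall>d\<in>A. (snd d \<circ> chart_inv c) holomorphic_on chart_image c (fst d))"

definition smooth_fun_on ::
    "('a::t2_space) chart set \<Rightarrow> 'a set \<Rightarrow> ('a \<Rightarrow> 'b::real_normed_vector) \<Rightarrow> bool" where
  "smooth_fun_on A W f \<longleftrightarrow> (\<forall>c\<in>A. smooth_on (chart_image c W) (f \<circ> chart_inv c))"

text \<open>\<open>diff c f x v\<close> is \<open>df\<close> at \<open>x\<close> applied to the tangent vector represented by \<open>v\<close> in the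
  chart \<open>c\<close>.\<close>

definition diff :: "'a chart \<Rightarrow> ('a \<Rightarrow> 'b::real_normed_vector) \<Rightarrow> 'a \<Rightarrow> complex \<Rightarrow> 'b" where
  "diff c f x v = frechet_derivative (f \<circ> chart_inv c) (at (snd c x)) v"

text \<open>A 1-form is given by its chart representations: \<open>\<eta> c x v\<close> is its value at \<open>x\<close> on the
  tangent vector represented by \<open>v\<close> in the chart \<open>c\<close>; the second clause is the transformation
  law. Its values for \<open>c\<close> outside the atlas or \<open>x\<close> outside the domain of \<open>c\<close> are irrelevant.\<close>

type_synonym ('a, 'b) form1 = "'a chart \<Rightarrow> 'a \<Rightarrow> complex \<Rightarrow> 'b"

definition smooth_one_form ::
    "('a::t2_space) chart set \<Rightarrow> ('a, 'b::real_normed_vector) form1 \<Rightarrow> bool" where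
  "smooth_one_form A \<eta> \<longleftrightarrow>
     (\<forall>c\<in>A. \<forall>x\<in>fst c. linear (\<eta> c x)) \<and>
     (\<forall>c\<in>A. \<forall>d\<in>A. \<forall>x\<in>fst c \<inter> fst d. \<forall>v. \<eta> c x v = \<eta> d x (diff c (snd d) x v)) \<and>
     (\<forall>c\<in>A. \<forall>v. smooth_on (chart_image c UNIV) (\<lambda>z. \<eta> c (chart_inv c z) v))"

text \<open>\<open>d\<eta>(v, w) = \<partial>\<^sub>v (\<eta>(w)) - \<partial>\<^sub>w (\<eta>(v))\<close> for constant vector fields \<open>v\<close>, \<open>w\<close> in a chart.\<close>

definition closed_one_form ::
    "('a::t2_space) chart set \<Rightarrow> ('a, 'b::real_normed_vector) form1 \<Rightarrow> bool" where
  "closed_one_form A \<eta> \<longleftrightarrow>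
     (\<forall>c\<in>A. \<forall>x\<in>fst c. \<forall>v w. diff c (\<lambda>y. \<eta> c y w) x v - diff c (\<lambda>y. \<eta> c y v) x w = 0)"

definition zero_set :: "'a chart set \<Rightarrow> ('a, 'b::zero) form1 \<Rightarrow> 'a set" where
  "zero_set A \<eta> = {x. \<forall>c\<in>A. x \<in> fst c \<longrightarrow> (\<forall>v. \<eta> c x v = 0)}"

section \<open>Isothermic surfaces in the conformal 3-sphere\<close>

text \<open>A point of the projectivised light-cone is a null line \<open>span {v}\<close> with \<open>v \<in> light_cone\<close>. A map
  \<open>\<Lambda>\<close> into it is a family of such lines, and it is smooth iff it is a smooth line subbundle, that
  is, has smooth nowhere zero local sections around every point.\<close>

definition local_section ::
    "('a::t2_space) chart set \<Rightarrow> ('a \<Rightarrow> R41 set) \<Rightarrow> 'a set \<Rightarrow> ('a \<Rightarrow> R41) \<Rightarrow> bool" where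
  "local_section A \<Lambda> V s \<longleftrightarrow>
     open V \<and> smooth_fun_on A V s \<and> (\<forall>x\<in>V. s x \<in> light_cone \<and> \<Lambda> x = span {s x})"

definition smooth_null_line_bundle :: "('a::t2_space) chart set \<Rightarrow> ('a \<Rightarrow> R41 set) \<Rightarrow> bool" where
  "smooth_null_line_bundle A \<Lambda> \<longleftrightarrow> (\<forall>x. \<exists>V s. x \<in> V \<and> local_section A \<Lambda> V s)"

text \<open>For a local section \<open>s\<close> of \<open>\<Lambda>\<close>, \<open>(ds, ds)\<close> is the pull-back by \<open>\<Lambda>\<close> of a metric in the conformal
  class of the projectivised light-cone. It has to be a positive multiple of the Euclidean metric of
  the holomorphic chart; positivity makes \<open>\<Lambda>\<close> an immersion.\<close>

definition conformal_immersion :: "('a::t2_space) chart set \<Rightarrow> ('a \<Rightarrow> R41 set) \<Rightarrow> bool" where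
  "conformal_immersion A \<Lambda> \<longleftrightarrow>
     smooth_null_line_bundle A \<Lambda> \<and>
     (\<forall>V s. local_section A \<Lambda> V s \<longrightarrow>
        (\<forall>c\<in>A. \<forall>x \<in> V \<inter> fst c. \<exists>m>0. \<forall>v w.
           lorentz (diff c s x v) (diff c s x w) = m * (v \<bullet> w)))"

definition lorentz_perp :: "R41 set \<Rightarrow> R41 set" where
  "lorentz_perp L = {v. \<forall>u\<in>L. lorentz u v = 0}"

definition wedge_space :: "R41 set \<Rightarrow> R41 set \<Rightarrow> (R41 \<Rightarrow>\<^sub>L R41) set" where
  "wedge_space L M = span {wedge u v | u v. u \<in> L \<and> v \<in> M}"

definition isothermic_surface ::
    "('a::t2_space) chart set \<Rightarrow> ('a \<Rightarrow> R41 set) \<Rightarrow> ('a, R41 \<Rightarrow>\<^sub>L R41) form1 \<Rightarrow> bool" where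
  "isothermic_surface A \<Lambda> \<eta> \<longleftrightarrow>
     conformal_immersion A \<Lambda> \<and>
     smooth_one_form A \<eta> \<and> closed_one_form A \<eta> \<and>
     (\<forall>c\<in>A. \<forall>x\<in>fst c. \<forall>v. \<eta> c x v \<in> wedge_space (\<Lambda> x) (lorentz_perp (\<Lambda> x))) \<and>
     zero_set A \<eta> \<noteq> UNIV"

section \<open>Formal conserved quantities\<close>

text \<open>A series \<open>\<Sum>i\<le>0. p\<^sub>i t\<^sup>i\<close> is the family \<open>p\<close> of its coefficients; only indices \<open>i \<le> 0\<close> are
  ever used. The last two clauses are the coefficients of \<open>t\<^sup>1\<close> and of \<open>t\<^sup>i\<close>, \<open>i \<le> 0\<close>, in
  \<open>(d + t\<eta>) p(t) = 0\<close>.\<close>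

definition formal_conserved_quantity ::
    "('a::t2_space) chart set \<Rightarrow> ('a, R41 \<Rightarrow>\<^sub>L R41) form1 \<Rightarrow> 'a set \<Rightarrow> (int \<Rightarrow> 'a \<Rightarrow> R41) \<Rightarrow> bool" where
  "formal_conserved_quantity A \<eta> W p \<longleftrightarrow>
     open W \<and>
     (\<forall>i\<le>0. smooth_fun_on A W (p i)) \<and>
     (\<exists>x\<in>W. p 0 x \<noteq> 0) \<and>
     (\<forall>c\<in>A. \<forall>x \<in> W \<inter> fst c. \<forall>v. blinfun_apply (\<eta> c x v) (p 0 x) = 0) \<and>
     (\<forall>i\<le>0. \<forall>c\<in>A. \<forall>x \<in> W \<inter> fst c. \<forall>v.
        diff c (p i) x v + blinfun_apply (\<eta> c x v) (p (i - 1) x) = 0)"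

definition series_inner :: "(int \<Rightarrow> 'a \<Rightarrow> R41) \<Rightarrow> (int \<Rightarrow> 'a \<Rightarrow> R41) \<Rightarrow> int \<Rightarrow> 'a \<Rightarrow> real" where
  "series_inner p q k x =
     (\<Sum>(i, j) \<in> {(i, j). i \<le> 0 \<and> j \<le> 0 \<and> i + j = k}. lorentz (p i x) (q j x))"

lemma finite_series_inner_indices: "finite {(i, j). i \<le> 0 \<and> j \<le> 0 \<and> i + j = (k::int)}"
  by (rule finite_subset[of _ "{k..0} \<times> {k..0}"]) auto

end

theory Submission
  imports Defs "HOL-Complex_Analysis.Conformal_Mappings"
begin

text \<open>
  Let \<open>\<sigma> = (y, 1)\<close> be the section of \<open>\<Lambda>\<close> with last coordinate 1, so that \<open>y\<close> is
  the surface as a map into the unit sphere of \<open>\<real>\<^sup>4\<close>, and let \<open>F\<close> be its expression in a chart. As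
  \<open>\<eta>\<close> takes values in \<open>\<Lambda> \<and> \<Lambda>\<^sup>\<bottom>\<close>, it is \<open>F \<and> W v\<close> on the coordinate vector \<open>v\<close>, for a unique
  \<open>W v\<close> in \<open>\<real>\<^sup>4 \<times> {0}\<close> orthogonal to \<open>F\<close>. Closedness of \<open>\<eta>\<close> says that \<open>W v\<close> is tangent to the surface
  and that \<open>Q = (W 1, \<partial>\<^sub>1 F) - \<i> (W 1, \<partial>\<^sub>\<i> F)\<close> satisfies the Cauchy-Riemann equations. So the zeros of \<open>\<eta>\<close>,
  which are those of \<open>Q\<close>, are isolated (the identity theorem and connectedness of the surface exclude
  open sets of zeros), and their complement is connected (\<open>connected_minus_zero_set\<close>).

  Put \<open>D\<^sub>v = \<partial>\<^sub>v + t \<eta>(v)\<close>. They commute, because \<open>\<eta>\<close> is closed and its values at a point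
  commute. The heart of the proof is that away from the zeros a single direction \<open>v\<close> determines everything, as long as \<open>W v\<close> is not parallel to
  \<open>\<partial>\<^sub>v F\<close>; one of the directions \<open>1\<close> and \<open>1 + \<i>\<close> has this property. In such a direction the
  equation \<open>D\<^sub>v u = 0\<close> for a formal series \<open>u\<close> determines each coefficient from the previous one by
  differentiation and linear algebra, up to its component along the unit normal \<open>n\<close>. Hence a solution
  which is orthogonal to a series with a leading coefficient orthogonal to \<open>F\<close> and with non-zero normal component vanishes
  (\<open>kernel_trivial\<close>). Three facts follow.

  \<^item> \<open>D\<^sub>v p = 0\<close> and \<open>(p, p) = r\<close> can be solved without any integration (\<open>formal_solution\<close>): take the normal
    component of each coefficient from the condition on \<open>(p, p)\<close>. Then \<open>D\<^sub>v p\<close> can only be a multiple of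
    \<open>n\<close>; its product with \<open>p\<close> vanishes, because \<open>(p, p)\<close> is constant and \<open>\<eta>\<close> is skew, and the leading
    coefficient of \<open>p\<close> has a non-zero normal component, so \<open>D\<^sub>v p = 0\<close>.

  \<^item> This \<open>p\<close> solves the equation in every direction \<open>w\<close> (\<open>one_direction_suffices\<close>): \<open>D\<^sub>w p\<close> is annihilated by
    \<open>D\<^sub>v\<close> and orthogonal to \<open>p\<close>, hence zero.

  \<^item> Two solutions \<open>p\<close>, \<open>q\<close> with the same square and leading normal components of the same sign
    coincide (\<open>conserved_unique\<close>): \<open>p - q\<close> is a solution orthogonal to \<open>p + q\<close>.

  The leading normal component is \<open>\<plusminus> sqrt (r 0)\<close>. Transition maps are holomorphic, hence preserve the
  orientation, so the unit normal given by the cross product of \<open>y\<close> and its two partial derivatives does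
  not depend on the chart (\<open>normal_transition\<close>). The local solutions with positive leading normal component
  therefore agree on overlaps and form the global \<open>p\<close>. Any other solution is \<open>p\<close> or \<open>- p\<close> near every
  point, and by connectedness the same sign occurs everywhere.
\<close>

section \<open>Calculus of smooth functions on open sets\<close>

definition dirD :: "'a \<Rightarrow> ('a::real_normed_vector \<Rightarrow> 'b::real_normed_vector) \<Rightarrow> 'a \<Rightarrow> 'b" where
  "dirD v f x = frechet_derivative f (at x) v"

lemma has_derivative_dirD: "f differentiable (at x) \<Longrightarrow> (f has_derivative (\<lambda>v. dirD v f x)) (at x)"
  unfolding dirD_def using frechet_derivative_works by blast

lemma dirD_eqI: "(f has_derivative f') (at x) \<Longrightarrow> dirD v f x = f' v"
  unfolding dirD_def by (metis frechet_derivative_at)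

lemma dirD_linear:
  assumes "f differentiable (at x)"
  shows "linear (\<lambda>v. dirD v f x)"
  unfolding dirD_def using assms linear_frechet_derivative by blast

lemma dirD_const [simp]: "dirD v (\<lambda>x. c) x = 0"
  by (simp add: dirD_def)

lemma dirD_cong:
  assumes "open S" "x \<in> S" "\<And>y. y \<in> S \<Longrightarrow> f y = g y" "f differentiable (at x)"
  shows "dirD v f x = dirD v g x"
  unfolding dirD_def using frechet_derivative_transform_within_open[of f x S g] assms by auto

lemma differentiable_cong:
  assumes "open S" "x \<in> S" "\<And>y. y \<in> S \<Longrightarrow> f y = g y" "f differentiable (at x)"
  shows "g differentiable (at x)"
  using assms has_derivative_transform_within_open unfolding differentiable_def by metis

lemma dirD_eq_0:
  assumes "open S" "x \<in> S" "\<And>y. y \<in> S \<Longrightarrow> f y = c"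
  shows "dirD v f x = 0"
proof -
  have "dirD v (\<lambda>_. c) x = dirD v f x"
    by (rule dirD_cong[OF assms(1,2)]) (auto simp: assms(3))
  then show ?thesis by simp
qed

lemma dirD_bilinear:
  assumes "bounded_bilinear B" "f differentiable (at x)" "g differentiable (at x)"
  shows "dirD v (\<lambda>x. B (f x) (g x)) x = B (f x) (dirD v g x) + B (dirD v f x) (g x)"
  using dirD_eqI[OF bounded_bilinear.FDERIV[OF assms(1) has_derivative_dirD has_derivative_dirD]]
    assms(2,3) by blast

lemma differentiable_bilinear:
  assumes "bounded_bilinear B" "f differentiable (at x)" "g differentiable (at x)"
  shows "(\<lambda>x. B (f x) (g x)) differentiable (at x)"
  using bounded_bilinear.FDERIV[OF assms(1) has_derivative_dirD has_derivative_dirD] assms(2,3)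
  unfolding differentiable_def by blast

lemma dirD_bounded_linear:
  assumes "bounded_linear L" "f differentiable (at x)"
  shows "dirD v (\<lambda>x. L (f x)) x = L (dirD v f x)"
  using dirD_eqI[OF bounded_linear.has_derivative[OF assms(1) has_derivative_dirD]] assms(2) by blast

lemma dirD_add:
  assumes "f differentiable (at x)" "g differentiable (at x)"
  shows "dirD v (\<lambda>x. f x + g x) x = dirD v f x + dirD v g x"
  using dirD_eqI[OF has_derivative_add[OF has_derivative_dirD has_derivative_dirD]] assms by blast

lemma dirD_diff:
  assumes "f differentiable (at x)" "g differentiable (at x)"
  shows "dirD v (\<lambda>x. f x - g x) x = dirD v f x - dirD v g x"
  using dirD_eqI[OF has_derivative_diff[OF has_derivative_dirD has_derivative_dirD]] assms by blast

lemma dirD_sum: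
  assumes "\<And>i. i \<in> I \<Longrightarrow> f i differentiable (at x)"
  shows "dirD v (\<lambda>x. \<Sum>i\<in>I. f i x) x = (\<Sum>i\<in>I. dirD v (f i) x)"
  using dirD_eqI[OF has_derivative_sum[OF has_derivative_dirD]] assms by blast

text \<open>The recursion in terms of \<open>dirD\<close>, whose rules for sums and products apply without unfolding.\<close>

lemma C_k_on_Suc:
  "C_k_on (Suc k) S f \<longleftrightarrow> (\<forall>x\<in>S. f differentiable (at x)) \<and> (\<forall>v. C_k_on k S (dirD v f))"
  by (simp add: dirD_def[abs_def])

declare C_k_on.simps(2) [simp del]

lemma C_k_on_SucD: "C_k_on (Suc k) S f \<Longrightarrow> C_k_on k S f"
proof (induction k arbitrary: f)
  case 0
  then show ?case
    by (auto simp: C_k_on_Suc intro!: continuous_at_imp_continuous_on differentiable_imp_continuous_within)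
next
  case (Suc k)
  then show ?case unfolding C_k_on_Suc[of "Suc k"] C_k_on_Suc[of k S f] by blast
qed

lemma C_k_on_subset: "C_k_on k S f \<Longrightarrow> T \<subseteq> S \<Longrightarrow> C_k_on k T f"
proof (induction k arbitrary: f)
  case 0
  then show ?case using continuous_on_subset by auto
next
  case (Suc k)
  then show ?case unfolding C_k_on_Suc by blast
qed

lemma C_k_on_cong:
  assumes "open S"
  shows "(\<And>x. x \<in> S \<Longrightarrow> f x = g x) \<Longrightarrow> C_k_on k S f \<Longrightarrow> C_k_on k S g"
proof (induction k arbitrary: f g)
  case 0
  then show ?case using continuous_on_cong by (metis C_k_on.simps(1))
next
  case (Suc k)
  have "g differentiable (at x)" if "x \<in> S" for x
    using differentiable_cong[OF assms that] Suc.prems that by (auto simp: C_k_on_Suc)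
  moreover have "C_k_on k S (dirD v g)" for v
    by (rule Suc.IH[of "dirD v f"])
      (use Suc.prems dirD_cong[OF assms, of _ f g] in \<open>auto simp: C_k_on_Suc\<close>)
  ultimately show ?case by (simp add: C_k_on_Suc)
qed

lemma C_k_on_local:
  "(\<And>x. x \<in> S \<Longrightarrow> \<exists>T. open T \<and> x \<in> T \<and> C_k_on k T f) \<Longrightarrow> C_k_on k S f"
proof (induction k arbitrary: f)
  case 0
  then show ?case
    by (metis C_k_on.simps(1) continuous_at_imp_continuous_on continuous_on_eq_continuous_at)
next
  case (Suc k)
  then show ?case unfolding C_k_on_Suc by meson
qed

lemma C_k_on_const [simp]: "C_k_on k S (\<lambda>x. c)"
proof (induction k arbitrary: c)
  case (Suc k)
  have "dirD v (\<lambda>x. c) = (\<lambda>x. 0)" for v :: 'a by (rule ext) simp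
  then show ?case using Suc by (auto simp: C_k_on_Suc)
qed auto

lemma C_k_on_add:
  assumes "open S"
  shows "C_k_on k S f \<Longrightarrow> C_k_on k S g \<Longrightarrow> C_k_on k S (\<lambda>x. f x + g x)"
proof (induction k arbitrary: f g)
  case (Suc k)
  have "C_k_on k S (dirD v (\<lambda>x. f x + g x))" for v
    by (rule C_k_on_cong[OF assms _ Suc.IH[of "dirD v f" "dirD v g"]])
      (use Suc.prems in \<open>auto simp: C_k_on_Suc dirD_add\<close>)
  then show ?case using Suc.prems by (auto simp: C_k_on_Suc)
qed (auto intro: continuous_intros)

lemma C_k_on_bounded_linear:
  assumes "open S" "bounded_linear L"
  shows "C_k_on k S f \<Longrightarrow> C_k_on k S (\<lambda>x. L (f x))"
proof (induction k arbitrary: f)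
  case 0
  then show ?case using bounded_linear.continuous_on[OF assms(2)] by auto
next
  case (Suc k)
  have "C_k_on k S (dirD v (\<lambda>x. L (f x)))" for v
    by (rule C_k_on_cong[OF assms(1) _ Suc.IH[of "dirD v f"]])
      (use Suc.prems in \<open>auto simp: C_k_on_Suc dirD_bounded_linear[OF assms(2)]\<close>)
  moreover have "(\<lambda>x. L (f x)) differentiable (at x)" if "x \<in> S" for x
    using Suc.prems that bounded_linear.has_derivative[OF assms(2)]
    unfolding C_k_on_Suc differentiable_def by blast
  ultimately show ?case by (auto simp: C_k_on_Suc)
qed

lemma C_k_on_bilinear:
  assumes "open S" "bounded_bilinear B"
  shows "C_k_on k S f \<Longrightarrow> C_k_on k S g \<Longrightarrow> C_k_on k S (\<lambda>x. B (f x) (g x))"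
proof (induction k arbitrary: f g)
  case 0
  then show ?case using bounded_bilinear.continuous_on[OF assms(2)] by auto
next
  case (Suc k)
  have "C_k_on k S (\<lambda>x. B (f x) (dirD v g x) + B (dirD v f x) (g x))" for v
    using Suc.prems C_k_on_SucD[OF Suc.prems(1)] C_k_on_SucD[OF Suc.prems(2)]
    by (intro C_k_on_add[OF assms(1)] Suc.IH) (auto simp: C_k_on_Suc)
  then have "C_k_on k S (dirD v (\<lambda>x. B (f x) (g x)))" for v
    by (rule C_k_on_cong[OF assms(1), rotated])
      (use Suc.prems in \<open>auto simp: C_k_on_Suc dirD_bilinear[OF assms(2)]\<close>)
  moreover have "(\<lambda>x. B (f x) (g x)) differentiable (at x)" if "x \<in> S" for x
    using Suc.prems that by (intro differentiable_bilinear[OF assms(2)]) (auto simp: C_k_on_Suc)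
  ultimately show ?case by (simp add: C_k_on_Suc)
qed

lemma C_k_on_inverse:
  fixes f :: "'a::real_normed_vector \<Rightarrow> real"
  assumes "open S" "\<And>x. x \<in> S \<Longrightarrow> f x \<noteq> 0"
  shows "C_k_on k S f \<Longrightarrow> C_k_on k S (\<lambda>x. inverse (f x))"
proof (induction k)
  case 0
  then show ?case using assms by (auto intro: continuous_intros)
next
  case (Suc k)
  have eq: "- (inverse (f x) * (dirD v f x * inverse (f x))) = dirD v (\<lambda>x. inverse (f x)) x"
    if "x \<in> S" for x v
    using dirD_eqI[OF Deriv.has_derivative_inverse[where f = f, OF assms(2)[OF that] has_derivative_dirD],
        of v] Suc.prems that
    by (simp add: C_k_on_Suc mult.assoc)
  have "C_k_on k S (\<lambda>x. - (inverse (f x) * (dirD v f x * inverse (f x))))" for v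
    using Suc C_k_on_SucD[OF Suc.prems]
    by (intro C_k_on_bounded_linear[OF assms(1) bounded_linear_minus[OF bounded_linear_ident]]
          C_k_on_bilinear[OF assms(1) bounded_bilinear_mult])
      (auto simp: C_k_on_Suc)
  then have "C_k_on k S (dirD v (\<lambda>x. inverse (f x)))" for v
    by (rule C_k_on_cong[OF assms(1), rotated]) (rule eq)
  moreover have "(\<lambda>x. inverse (f x)) differentiable (at x)" if "x \<in> S" for x
    using Suc.prems that assms(2)[OF that] by (auto simp: C_k_on_Suc intro!: differentiable_inverse)
  ultimately show ?case by (simp add: C_k_on_Suc)
qed

lemma smooth_on_differentiable: "smooth_on S f \<Longrightarrow> x \<in> S \<Longrightarrow> f differentiable (at x)"
  unfolding smooth_on_def using C_k_on_Suc by blast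

lemma smooth_on_continuous: "smooth_on S f \<Longrightarrow> continuous_on S f"
  unfolding smooth_on_def by (metis C_k_on.simps(1))

lemma smooth_on_subset: "smooth_on S f \<Longrightarrow> T \<subseteq> S \<Longrightarrow> smooth_on T f"
  unfolding smooth_on_def using C_k_on_subset by blast

lemma smooth_on_cong:
  "open S \<Longrightarrow> smooth_on S f \<Longrightarrow> (\<And>x. x \<in> S \<Longrightarrow> f x = g x) \<Longrightarrow> smooth_on S g"
  unfolding smooth_on_def using C_k_on_cong by metis

text \<open>Smoothness is a local property; this lets local formulas prove smoothness of glued functions.\<close>

lemma smooth_on_local:
  "(\<And>x. x \<in> S \<Longrightarrow> \<exists>T. open T \<and> x \<in> T \<and> smooth_on T f) \<Longrightarrow> smooth_on S f"
  unfolding smooth_on_def using C_k_on_local by metis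

lemma smooth_on_dirD: "smooth_on S f \<Longrightarrow> smooth_on S (dirD v f)"
  unfolding smooth_on_def using C_k_on_Suc by blast

lemma smooth_on_const: "smooth_on S (\<lambda>x. c)"
  by (simp add: smooth_on_def)

lemma smooth_on_add:
  "open S \<Longrightarrow> smooth_on S f \<Longrightarrow> smooth_on S g \<Longrightarrow> smooth_on S (\<lambda>x. f x + g x)"
  by (simp add: smooth_on_def C_k_on_add)

lemma smooth_on_bounded_linear:
  "bounded_linear L \<Longrightarrow> open S \<Longrightarrow> smooth_on S f \<Longrightarrow> smooth_on S (\<lambda>x. L (f x))"
  by (simp add: smooth_on_def C_k_on_bounded_linear)

lemma smooth_on_bilinear:
  "bounded_bilinear B \<Longrightarrow> open S \<Longrightarrow> smooth_on S f \<Longrightarrow> smooth_on S g \<Longrightarrow>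
    smooth_on S (\<lambda>x. B (f x) (g x))"
  by (simp add: smooth_on_def C_k_on_bilinear)

lemmas smooth_on_minus = smooth_on_bounded_linear[OF bounded_linear_minus[OF bounded_linear_ident]]
lemmas smooth_on_scaleR = smooth_on_bilinear[OF bounded_bilinear_scaleR]
lemmas smooth_on_mult = smooth_on_bilinear[OF bounded_bilinear_mult]

lemma smooth_on_diff:
  assumes "open S" "smooth_on S f" "smooth_on S g"
  shows "smooth_on S (\<lambda>x. f x - g x)"
  using smooth_on_add[OF assms(1,2) smooth_on_minus[OF assms(1,3)]] by simp

lemma smooth_on_sum:
  assumes "open S"
  shows "(\<And>i. i \<in> I \<Longrightarrow> smooth_on S (f i)) \<Longrightarrow> smooth_on S (\<lambda>x. \<Sum>i\<in>I. f i x)"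
proof (induction I rule: infinite_finite_induct)
  case (insert i I)
  then show ?case using assms by (simp add: smooth_on_add)
qed (simp_all add: smooth_on_const)

lemma smooth_on_divide:
  fixes f g :: "'a::real_normed_vector \<Rightarrow> real"
  assumes "open S" "\<And>x. x \<in> S \<Longrightarrow> g x \<noteq> 0" "smooth_on S f" "smooth_on S g"
  shows "smooth_on S (\<lambda>x. f x / g x)"
proof -
  have "smooth_on S (\<lambda>x. inverse (g x))"
    using C_k_on_inverse[where f = g, OF assms(1,2)] assms(4) unfolding smooth_on_def by blast
  then show ?thesis unfolding divide_inverse by (intro smooth_on_mult assms)
qed

lemma smooth_on_vec:
  fixes f :: "'a::real_normed_vector \<Rightarrow> real ^ 'n"
  assumes "open S" "\<And>i. smooth_on S (\<lambda>x. f x $ i)"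
  shows "smooth_on S f"
proof -
  have "smooth_on S (\<lambda>x. \<Sum>i\<in>UNIV. (f x $ i) *\<^sub>R axis i (1::real))"
    by (intro smooth_on_sum smooth_on_scaleR assms smooth_on_const)
  then show ?thesis by (rule smooth_on_cong[OF assms(1)]) (simp add: vec_eq_iff axis_def sum.delta' if_distrib cong: if_cong)
qed

section \<open>Symmetry of second derivatives\<close>

lemma mvt_direction:
  fixes h :: "'a::real_normed_vector \<Rightarrow> real"
  assumes "0 < t" "\<And>s. 0 \<le> s \<Longrightarrow> s \<le> t \<Longrightarrow> h differentiable (at (x + s *\<^sub>R v))"
  obtains s where "0 < s" "s < t" "h (x + t *\<^sub>R v) - h x = t * dirD v h (x + s *\<^sub>R v)"
proof -
  have "((\<lambda>s. h (x + s *\<^sub>R v)) has_real_derivative dirD v h (x + s *\<^sub>R v)) (at s)"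
    if "0 \<le> s" "s \<le> t" for s
  proof -
    have "((\<lambda>s. h (x + s *\<^sub>R v)) has_derivative (\<lambda>r. dirD (r *\<^sub>R v) h (x + s *\<^sub>R v))) (at s)"
      by (rule has_derivative_compose[where f = "\<lambda>s. x + s *\<^sub>R v" and f' = "\<lambda>r. r *\<^sub>R v" and g = h,
          OF _ has_derivative_dirD[OF assms(2)[OF that]]])
        (auto intro!: derivative_eq_intros)
    then show ?thesis
      by (simp add: has_field_derivative_def linear_scale[OF dirD_linear[OF assms(2)[OF that]]]
          mult_commute_abs)
  qed
  from MVT2[OF assms(1) this] that show ?thesis by auto
qed

text \<open>Two applications of the mean value theorem, in direction \<open>v\<close> and then in direction \<open>w\<close>. The left hand
  side is symmetric in \<open>v\<close> and \<open>w\<close>, which gives Schwarz' theorem when \<open>t\<close> tends to 0.\<close>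

lemma second_difference:
  fixes f :: "'a::real_normed_vector \<Rightarrow> real"
  assumes "0 < t"
    and box: "\<And>r s. 0 \<le> r \<Longrightarrow> r \<le> t \<Longrightarrow> 0 \<le> s \<Longrightarrow> s \<le> t \<Longrightarrow> x + r *\<^sub>R v + s *\<^sub>R w \<in> S"
    and f: "smooth_on S f"
  obtains r s where "0 < r" "r < t" "0 < s" "s < t"
    "f (x + t *\<^sub>R v + t *\<^sub>R w) - f (x + t *\<^sub>R v) - (f (x + t *\<^sub>R w) - f x) =
      t * (t * dirD w (dirD v f) (x + r *\<^sub>R v + s *\<^sub>R w))"
proof -
  let ?g = "\<lambda>y. f (y + t *\<^sub>R w) - f y"
  have d: "f differentiable (at (x + s *\<^sub>R v + t *\<^sub>R w))" "f differentiable (at (x + s *\<^sub>R v))"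
    if "0 \<le> s" "s \<le> t" for s
    using smooth_on_differentiable[OF f] box[OF that, of t] box[OF that, of 0] assms(1) by auto
  have hd: "(?g has_derivative (\<lambda>u. dirD u f (x + s *\<^sub>R v + t *\<^sub>R w) - dirD u f (x + s *\<^sub>R v)))
      (at (x + s *\<^sub>R v))" if "0 \<le> s" "s \<le> t" for s
    by (intro has_derivative_compose[where f = "\<lambda>y. y + t *\<^sub>R w" and f' = "\<lambda>u. u" and g = f,
        OF _ has_derivative_dirD[OF d(1)[OF that]]] has_derivative_diff has_derivative_dirD d that) (auto intro!: derivative_eq_intros)
  obtain r where r: "0 < r" "r < t" "?g (x + t *\<^sub>R v) - ?g x = t * dirD v ?g (x + r *\<^sub>R v)"
    by (rule mvt_direction[OF assms(1), of ?g x v])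
      (use hd in \<open>auto simp: differentiable_def simp del: add_uminus_conv_diff\<close>)
  have "dirD v ?g (x + r *\<^sub>R v) = dirD v f (x + r *\<^sub>R v + t *\<^sub>R w) - dirD v f (x + r *\<^sub>R v)"
    using dirD_eqI[OF hd, of r v] r by simp
  moreover obtain s where "0 < s" "s < t"
    "dirD v f (x + r *\<^sub>R v + t *\<^sub>R w) - dirD v f (x + r *\<^sub>R v) =
      t * dirD w (dirD v f) (x + r *\<^sub>R v + s *\<^sub>R w)"
    by (rule mvt_direction[OF assms(1), of "dirD v f" "x + r *\<^sub>R v" w])
      (use smooth_on_differentiable[OF smooth_on_dirD[OF f]] box r in auto)
  ultimately show ?thesis using r that by auto
qed

lemma dirD_commute_real:
  fixes f :: "'a::real_normed_vector \<Rightarrow> real"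
  assumes S: "open S" and f: "smooth_on S f" and x: "x \<in> S"
  shows "dirD v (dirD w f) x = dirD w (dirD v f) x"
proof (rule ccontr)
  let ?a = "dirD w (dirD v f)" and ?b = "dirD v (dirD w f)"
  assume neq: "?b x \<noteq> ?a x"
  define e where "e = \<bar>?a x - ?b x\<bar> / 2"
  have e: "e > 0" using neq by (simp add: e_def)
  have "isCont ?a x" "isCont ?b x"
    using smooth_on_continuous[OF smooth_on_dirD[OF smooth_on_dirD[OF f]]] S x
      continuous_on_eq_continuous_at by blast+
  then obtain d1 d2 where d: "d1 > 0" "\<And>y. dist y x < d1 \<Longrightarrow> \<bar>?a y - ?a x\<bar> < e"
      "d2 > 0" "\<And>y. dist y x < d2 \<Longrightarrow> \<bar>?b y - ?b x\<bar> < e"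
    unfolding continuous_at_eps_delta dist_real_def using e by metis
  obtain d3 where d3: "d3 > 0" "\<And>y. dist y x < d3 \<Longrightarrow> y \<in> S"
    using S x by (metis open_dist)
  define D where "D = min d1 (min d2 d3)"
  define t where "t = D / (norm v + norm w + 1)"
  have D: "D > 0" using d d3 by (simp add: D_def)
  have n1: "norm v + norm w + 1 > 0" by (smt (verit) norm_ge_zero)
  then have t: "t > 0" using D by (simp add: t_def)
  have near: "dist (x + r *\<^sub>R v + s *\<^sub>R w) x < D"
    if "0 \<le> r" "r \<le> t" "0 \<le> s" "s \<le> t" for r s
  proof -
    have "dist (x + r *\<^sub>R v + s *\<^sub>R w) x \<le> r * norm v + s * norm w"
      using norm_triangle_ineq[of "r *\<^sub>R v" "s *\<^sub>R w"] that by (simp add: dist_norm add.assoc)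
    also have "\<dots> \<le> t * (norm v + norm w)"
      using that by (simp add: distrib_left add_mono mult_right_mono)
    also have "\<dots> < t * (norm v + norm w + 1)" using t by simp
    also have "\<dots> = D" using n1 by (simp add: t_def)
    finally show ?thesis .
  qed
  have bx: "x + r *\<^sub>R v + s *\<^sub>R w \<in> S" "x + r *\<^sub>R w + s *\<^sub>R v \<in> S"
    if "0 \<le> r" "r \<le> t" "0 \<le> s" "s \<le> t" for r s
    using near[OF that] near[OF that(3,4,1,2)] d3
    by (auto simp: D_def algebra_simps)
  obtain r s where 1: "0 < r" "r < t" "0 < s" "s < t"
    "f (x + t *\<^sub>R v + t *\<^sub>R w) - f (x + t *\<^sub>R v) - (f (x + t *\<^sub>R w) - f x) =
      t * (t * ?a (x + r *\<^sub>R v + s *\<^sub>R w))"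
    by (rule second_difference[where x = x and v = v and w = w, OF t bx(1) f])
  obtain r' s' where 2: "0 < r'" "r' < t" "0 < s'" "s' < t"
    "f (x + t *\<^sub>R w + t *\<^sub>R v) - f (x + t *\<^sub>R w) - (f (x + t *\<^sub>R v) - f x) =
      t * (t * ?b (x + r' *\<^sub>R w + s' *\<^sub>R v))"
    by (rule second_difference[where x = x and v = w and w = v, OF t bx(2) f])
  have "t * (t * ?a (x + r *\<^sub>R v + s *\<^sub>R w)) = t * (t * ?b (x + s' *\<^sub>R v + r' *\<^sub>R w))"
    using 1(5) 2(5) by (simp add: algebra_simps)
  then have eq: "?a (x + r *\<^sub>R v + s *\<^sub>R w) = ?b (x + s' *\<^sub>R v + r' *\<^sub>R w)" using t by simp
  have a: "\<bar>?a (x + r *\<^sub>R v + s *\<^sub>R w) - ?a x\<bar> < e"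
    using near[of r s] 1 d(2) by (simp add: D_def)
  have b: "\<bar>?b (x + s' *\<^sub>R v + r' *\<^sub>R w) - ?b x\<bar> < e"
    using near[of s' r'] 2 d(4) by (simp add: D_def)
  have "2 * e = \<bar>?a x - ?b x\<bar>" by (simp add: e_def)
  with a b show False unfolding eq by linarith
qed

text \<open>Schwarz' theorem, reduced to real functions by pairing with constant vectors.\<close>

lemma dirD_commute:
  fixes f :: "'a::real_normed_vector \<Rightarrow> 'b::real_inner"
  assumes S: "open S" and f: "smooth_on S f" and x: "x \<in> S"
  shows "dirD v (dirD w f) x = dirD w (dirD v f) x"
proof -
  have "dirD v (dirD w f) x \<bullet> b = dirD w (dirD v f) x \<bullet> b" for b
  proof -
    have *: "dirD u (dirD u' (\<lambda>y. f y \<bullet> b)) x = dirD u (dirD u' f) x \<bullet> b" for u u'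
    proof -
      have "dirD u (dirD u' (\<lambda>y. f y \<bullet> b)) x = dirD u (\<lambda>y. dirD u' f y \<bullet> b) x"
        using smooth_on_differentiable[OF smooth_on_dirD[OF smooth_on_bounded_linear[OF
                bounded_linear_inner_left S f]] x]
          smooth_on_differentiable[OF f]
        by (intro dirD_cong[OF S x]) (auto simp: dirD_bounded_linear[OF bounded_linear_inner_left])
      also have "\<dots> = dirD u (dirD u' f) x \<bullet> b"
        using smooth_on_differentiable[OF smooth_on_dirD[OF f] x]
        by (simp add: dirD_bounded_linear[OF bounded_linear_inner_left])
      finally show ?thesis .
    qed
    show ?thesis
      using dirD_commute_real[OF S smooth_on_bounded_linear[OF bounded_linear_inner_left S f] x, of v w b]
      by (simp only: *)
  qed
  then show ?thesis by (metis inner_commute vector_eq_ldot)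
qed

section \<open>The Lorentzian inner product\<close>

lemma bounded_bilinear_lorentz: "bounded_bilinear lorentz"
proof
  show "\<exists>K. \<forall>u v. norm (lorentz u v) \<le> norm u * norm v * K"
  proof (intro exI allI)
    fix u v :: R41
    have le: "norm (fst x) \<le> norm x" "\<bar>snd x\<bar> \<le> norm x" for x :: R41
      using norm_fst_le[of "fst x" "snd x"] norm_snd_le[of "snd x" "fst x"] by simp_all
    have "\<bar>fst u \<bullet> fst v\<bar> \<le> norm u * norm v"
      by (rule order_trans[OF Cauchy_Schwarz_ineq2 mult_mono[OF le(1) le(1)]]) simp_all
    moreover have "\<bar>snd u * snd v\<bar> \<le> norm u * norm v"
      unfolding abs_mult by (rule mult_mono[OF le(2) le(2)]) simp_all
    ultimately show "norm (lorentz u v) \<le> norm u * norm v * 2"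
      unfolding lorentz_def real_norm_def by linarith
  qed
qed (simp_all add: lorentz_def inner_add_left inner_add_right distrib_left distrib_right
    right_diff_distrib)

lemma lorentz_commute: "lorentz u v = lorentz v u"
  by (simp add: lorentz_def inner_commute)

lemma lorentz_linear [simp]:
  "lorentz (u + v) w = lorentz u w + lorentz v w" "lorentz w (u + v) = lorentz w u + lorentz w v"
  "lorentz (u - v) w = lorentz u w - lorentz v w" "lorentz w (u - v) = lorentz w u - lorentz w v"
  "lorentz (- u) w = - lorentz u w" "lorentz w (- u) = - lorentz w u"
  "lorentz (c *\<^sub>R u) w = c * lorentz u w" "lorentz w (c *\<^sub>R u) = c * lorentz w u"
  "lorentz 0 w = 0" "lorentz w 0 = 0"
  by (simp_all add: lorentz_def inner_add_left inner_add_right inner_diff_left inner_diff_right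
      distrib_left distrib_right right_diff_distrib left_diff_distrib)

lemmas smooth_on_lorentz = smooth_on_bilinear[OF bounded_bilinear_lorentz]
lemmas dirD_lorentz = dirD_bilinear[OF bounded_bilinear_lorentz]
lemmas dirD_scaleR = dirD_bilinear[OF bounded_bilinear_scaleR]

definition e0 :: R41 where "e0 = (0, 1)"

lemma lorentz_e0 [simp]: "lorentz e0 v = - snd v" "lorentz v e0 = - snd v"
  by (simp_all add: e0_def lorentz_def)

text \<open>Five pairwise orthogonal non-zero vectors do not fit into \<open>\<real>\<^sup>4\<close>.\<close>

lemma orthogonal_to_four_eq_0:
  fixes a b c d x :: "real ^ 4"
  assumes nz: "a \<noteq> 0" "b \<noteq> 0" "c \<noteq> 0" "d \<noteq> 0"
    and orth: "a \<bullet> b = 0" "a \<bullet> c = 0" "a \<bullet> d = 0" "b \<bullet> c = 0" "b \<bullet> d = 0" "c \<bullet> d = 0"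
    and x: "a \<bullet> x = 0" "b \<bullet> x = 0" "c \<bullet> x = 0" "d \<bullet> x = 0"
  shows "x = 0"
proof (rule ccontr)
  assume "x \<noteq> 0"
  let ?B = "{a, b, c, d, x}"
  have "pairwise orthogonal ?B"
    using orth x
    by (auto simp: pairwise_insert orthogonal_def inner_commute[of b a] inner_commute[of c a]
        inner_commute[of d a] inner_commute[of x a] inner_commute[of c b] inner_commute[of d b]
        inner_commute[of x b] inner_commute[of d c] inner_commute[of x c] inner_commute[of x d])
  moreover have "0 \<notin> ?B" using nz \<open>x \<noteq> 0\<close> by auto
  ultimately have "independent ?B" by (rule pairwise_orthogonal_independent)
  then have le: "card ?B \<le> 4" using independent_bound[of ?B] by simp
  have ne: "u \<noteq> v" if "u \<bullet> v = 0" "u \<noteq> 0" for u v :: "real ^ 4" using that by auto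
  have "distinct [a, b, c, d, x]" by (simp add: ne orth x nz)
  from distinct_card[OF this] have "card ?B = 5" by simp
  with le show False by linarith
qed

section \<open>The cross product of three vectors in four-space\<close>

text \<open>The Hodge dual of \<open>u \<and> v \<and> w\<close>; its coordinates are the signed \<open>3 \<times> 3\<close> minors of the matrix with
  rows \<open>u\<close>, \<open>v\<close>, \<open>w\<close>.\<close>

definition cross4 :: "real ^ 4 \<Rightarrow> real ^ 4 \<Rightarrow> real ^ 4 \<Rightarrow> real ^ 4" where
  "cross4 u v w = (let d = (\<lambda>i j k.
       u $ i * (v $ j * w $ k - v $ k * w $ j) - u $ j * (v $ i * w $ k - v $ k * w $ i)
       + u $ k * (v $ i * w $ j - v $ j * w $ i))
     in (\<chi> i. if i = 1 then d 2 3 4 else if i = 2 then - d 1 3 4 else if i = 3 then d 1 2 4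
              else - d 1 2 3))"

lemma cross4_nth:
  "cross4 u v w $ 1 = u $ 2 * (v $ 3 * w $ 4 - v $ 4 * w $ 3) - u $ 3 * (v $ 2 * w $ 4 - v $ 4 * w $ 2)
     + u $ 4 * (v $ 2 * w $ 3 - v $ 3 * w $ 2)"
  "cross4 u v w $ 2 = - (u $ 1 * (v $ 3 * w $ 4 - v $ 4 * w $ 3) - u $ 3 * (v $ 1 * w $ 4 - v $ 4 * w $ 1)
     + u $ 4 * (v $ 1 * w $ 3 - v $ 3 * w $ 1))"
  "cross4 u v w $ 3 = u $ 1 * (v $ 2 * w $ 4 - v $ 4 * w $ 2) - u $ 2 * (v $ 1 * w $ 4 - v $ 4 * w $ 1)
     + u $ 4 * (v $ 1 * w $ 2 - v $ 2 * w $ 1)"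
  "cross4 u v w $ 4 = - (u $ 1 * (v $ 2 * w $ 3 - v $ 3 * w $ 2) - u $ 2 * (v $ 1 * w $ 3 - v $ 3 * w $ 1)
     + u $ 3 * (v $ 1 * w $ 2 - v $ 2 * w $ 1))"
  by (simp_all add: cross4_def Let_def)

lemma inner_4: "(x :: real ^ 4) \<bullet> y = x $ 1 * y $ 1 + x $ 2 * y $ 2 + x $ 3 * y $ 3 + x $ 4 * y $ 4"
  by (simp add: inner_vec_def sum_4)

lemma cross4_orthogonal:
  "u \<bullet> cross4 u v w = 0" "v \<bullet> cross4 u v w = 0" "w \<bullet> cross4 u v w = 0"
  by (simp_all add: inner_4 cross4_nth algebra_simps)

text \<open>Lagrange's identity: the squared length is the Gram determinant.\<close>

lemma cross4_gram:
  "cross4 u v w \<bullet> cross4 u v w =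
     (u \<bullet> u) * ((v \<bullet> v) * (w \<bullet> w) - (v \<bullet> w) * (v \<bullet> w))
     - (u \<bullet> v) * ((u \<bullet> v) * (w \<bullet> w) - (v \<bullet> w) * (u \<bullet> w))
     + (u \<bullet> w) * ((u \<bullet> v) * (v \<bullet> w) - (v \<bullet> v) * (u \<bullet> w))"
  unfolding inner_4 cross4_nth by algebra

text \<open>Multiplication of the pair \<open>(v, w)\<close> by the complex number \<open>a + \<i> b\<close> has determinant \<open>a\<^sup>2 + b\<^sup>2\<close>. This is
  why a holomorphic change of coordinates preserves the normal direction.\<close>

lemma cross4_rotate:
  "cross4 u (a *\<^sub>R v + b *\<^sub>R w) (a *\<^sub>R w - b *\<^sub>R v) = (a * a + b * b) *\<^sub>R cross4 u v w"
  by (simp add: vec_eq_iff forall_4 cross4_nth algebra_simps)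

lemma smooth_on_cross4:
  assumes S: "open S" and "smooth_on S u" "smooth_on S v" "smooth_on S w"
  shows "smooth_on S (\<lambda>z. cross4 (u z) (v z) (w z))"
proof -
  have c: "smooth_on S (\<lambda>z. f z $ i)" if "smooth_on S f" for f :: "'a \<Rightarrow> real ^ 4" and i
    using that by (rule smooth_on_bounded_linear[OF bounded_linear_vec_nth S])
  have "\<forall>i. smooth_on S (\<lambda>z. cross4 (u z) (v z) (w z) $ i)"
    unfolding forall_4 cross4_nth
    by (intro conjI smooth_on_add smooth_on_diff smooth_on_mult smooth_on_minus c assms)
  from this[rule_format] show ?thesis by (rule smooth_on_vec[OF S])
qed

section \<open>Formal series\<close>

text \<open>From here on \<open>u k\<close> is the coefficient of \<open>t\<^sup>-\<^sup>k\<close>.\<close>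

definition series_prod :: "(nat \<Rightarrow> 'a \<Rightarrow> R41) \<Rightarrow> (nat \<Rightarrow> 'a \<Rightarrow> R41) \<Rightarrow> nat \<Rightarrow> 'a \<Rightarrow> real" where
  "series_prod u w k z = (\<Sum>i\<le>k. lorentz (u i z) (w (k - i) z))"

lemma sum_atMost_reflect: "(\<Sum>i\<le>(k::nat). f i (k - i)) = (\<Sum>i\<le>k. f (k - i) (i::nat))"
  using sum.atLeastAtMost_rev[of "\<lambda>i. f i (k - i)" 0 k] by (simp add: atMost_atLeast0)

lemma series_prod_commute: "series_prod u w k z = series_prod w u k z"
  unfolding series_prod_def
  by (subst sum_atMost_reflect) (simp add: lorentz_commute)

text \<open>The coefficient form of \<open>(L p(t), p(t)) = 0\<close> for a skew map \<open>L\<close>.\<close>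

lemma series_prod_skew:
  assumes "\<And>a b. lorentz (L a) b = - lorentz a (L b)"
  shows "(\<Sum>i\<le>k. lorentz (L (p i)) (p (k - i :: nat))) = 0"
proof -
  have "(\<Sum>i\<le>k. lorentz (L (p i)) (p (k - i))) = (\<Sum>i\<le>k. lorentz (L (p (k - i))) (p i))"
    by (rule sum_atMost_reflect)
  also have "\<dots> = - (\<Sum>i\<le>k. lorentz (L (p i)) (p (k - i)))"
    unfolding sum_negf[symmetric] by (intro sum.cong refl) (metis assms lorentz_commute)
  finally show ?thesis by simp
qed

text \<open>The coefficient form of \<open>(\<partial>\<^sub>v p(t), p(t)) = 0\<close> for a series with constant square.\<close>

lemma series_prod_deriv:
  assumes S: "open S" "z \<in> S" and d: "\<And>i. p i differentiable (at z)"
    and c: "\<And>y. y \<in> S \<Longrightarrow> series_prod p p k y = c"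
  shows "(\<Sum>i\<le>k. lorentz (dirD v (p i) z) (p (k - i) z)) = 0"
proof -
  have "0 = dirD v (series_prod p p k) z"
    by (rule dirD_eq_0[OF S c, symmetric])
  also have "\<dots> = (\<Sum>i\<le>k. dirD v (\<lambda>z. lorentz (p i z) (p (k - i) z)) z)"
    unfolding series_prod_def[abs_def]
    by (rule dirD_sum) (intro differentiable_bilinear[OF bounded_bilinear_lorentz] d)
  also have "\<dots> = (\<Sum>i\<le>k. lorentz (p i z) (dirD v (p (k - i)) z)) +
      (\<Sum>i\<le>k. lorentz (dirD v (p i) z) (p (k - i) z))"
    by (simp add: dirD_lorentz[OF d d] sum.distrib)
  also have "(\<Sum>i\<le>k. lorentz (p i z) (dirD v (p (k - i)) z)) =
      (\<Sum>i\<le>k. lorentz (dirD v (p i) z) (p (k - i) z))"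
    by (subst sum_atMost_reflect) (simp add: lorentz_commute)
  finally show ?thesis by simp
qed

section \<open>The formal equation in one direction\<close>

text \<open>The data seen by one fixed direction \<open>v\<close>: the null vector \<open>F\<close>, its derivative \<open>\<partial>\<^sub>v F\<close>, the vector \<open>W\<close> with
  \<open>\<eta>(v) = F \<and> W\<close>, and the unit normal \<open>n\<close>. The last assumption, a non-zero Gram determinant, says that
  \<open>\<partial>\<^sub>v F\<close> and \<open>W\<close> span the tangent plane.\<close>

locale direction_frame =
  fixes S :: "'a::real_normed_vector set" and v :: 'a and F W n :: "'a \<Rightarrow> R41"
  assumes open_S: "open S"
    and smooth_F: "smooth_on S F" and smooth_W: "smooth_on S W" and smooth_n: "smooth_on S n"
    and snd_F: "z \<in> S \<Longrightarrow> snd (F z) = 1" and snd_W: "z \<in> S \<Longrightarrow> snd (W z) = 0"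
    and snd_n: "z \<in> S \<Longrightarrow> snd (n z) = 0"
    and FF: "z \<in> S \<Longrightarrow> lorentz (F z) (F z) = 0" and FW: "z \<in> S \<Longrightarrow> lorentz (F z) (W z) = 0"
    and Fn: "z \<in> S \<Longrightarrow> lorentz (F z) (n z) = 0"
    and nF1: "z \<in> S \<Longrightarrow> lorentz (n z) (dirD v F z) = 0" and nW: "z \<in> S \<Longrightarrow> lorentz (n z) (W z) = 0"
    and nn: "z \<in> S \<Longrightarrow> lorentz (n z) (n z) = 1"
    and independent: "z \<in> S \<Longrightarrow> lorentz (dirD v F z) (dirD v F z) * lorentz (W z) (W z)
       - lorentz (dirD v F z) (W z) * lorentz (dirD v F z) (W z) \<noteq> 0"
begin

text \<open>The endomorphism \<open>F \<and> W\<close>.\<close>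

definition E :: "'a \<Rightarrow> R41 \<Rightarrow> R41" where
  "E z q = lorentz (F z) q *\<^sub>R W z - lorentz (W z) q *\<^sub>R F z"

definition \<Delta> :: "'a \<Rightarrow> real" where
  "\<Delta> z = lorentz (dirD v F z) (dirD v F z) * lorentz (W z) (W z)
       - lorentz (dirD v F z) (W z) * lorentz (dirD v F z) (W z)"

text \<open>The tangential vector orthogonal to \<open>W\<close>.\<close>

definition X :: "'a \<Rightarrow> R41" where
  "X z = lorentz (W z) (W z) *\<^sub>R dirD v F z - lorentz (dirD v F z) (W z) *\<^sub>R W z"

lemma F_diff: "z \<in> S \<Longrightarrow> F differentiable (at z)"
  using smooth_F smooth_on_differentiable by blast

lemma snd_F1: assumes "z \<in> S" shows "snd (dirD v F z) = 0"
  using dirD_eq_0[OF open_S assms, of "\<lambda>z. snd (F z)" 1 v] snd_F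
    dirD_bounded_linear[OF bounded_linear_snd F_diff[OF assms], of v] by simp

lemma FF1: assumes "z \<in> S" shows "lorentz (F z) (dirD v F z) = 0"
  using dirD_eq_0[OF open_S assms, of "\<lambda>z. lorentz (F z) (F z)" 0 v] FF
    dirD_lorentz[OF F_diff[OF assms] F_diff[OF assms], of v] by (simp add: lorentz_commute)

lemma \<Delta>_nz: "z \<in> S \<Longrightarrow> \<Delta> z \<noteq> 0"
  using independent by (simp add: \<Delta>_def)

lemma WW_nz: assumes "z \<in> S" shows "lorentz (W z) (W z) \<noteq> 0"
proof
  assume "lorentz (W z) (W z) = 0"
  then have "W z = 0" using snd_W[OF assms] by (simp add: lorentz_def prod_eq_iff)
  then show False using independent[OF assms] by simp
qed

lemmas frame = snd_F snd_W snd_n snd_F1 FF FW Fn nF1 nW nn FF1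

lemma frame' : 
  "z \<in> S \<Longrightarrow> lorentz (W z) (F z) = 0" "z \<in> S \<Longrightarrow> lorentz (n z) (F z) = 0"
  "z \<in> S \<Longrightarrow> lorentz (dirD v F z) (n z) = 0" "z \<in> S \<Longrightarrow> lorentz (W z) (n z) = 0"
  "z \<in> S \<Longrightarrow> lorentz (dirD v F z) (F z) = 0"
  using frame by (simp_all add: lorentz_commute)

lemma X_frame:
  assumes "z \<in> S"
  shows "lorentz (X z) (F z) = 0" "lorentz (X z) (W z) = 0" "lorentz (X z) (n z) = 0"
    "lorentz (X z) (dirD v F z) = \<Delta> z" "snd (X z) = 0" "lorentz (F z) (X z) = 0"
  using frame[OF assms] frame'[OF assms]
  by (simp_all add: X_def \<Delta>_def algebra_simps lorentz_commute[of "W z" "dirD v F z"])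

text \<open>The vectors \<open>F\<close>, \<open>X\<close>, \<open>W\<close>, \<open>n\<close> and \<open>e0\<close> form a basis, as the parts of the first four in \<open>\<real>\<^sup>4\<close> are
  pairwise orthogonal.\<close>

lemma orthogonal_to_frame_eq_0:
  assumes z: "z \<in> S" and x: "snd x = 0" "lorentz (F z) x = 0" "lorentz (X z) x = 0"
    "lorentz (W z) x = 0" "lorentz (n z) x = 0"
  shows "x = 0"
proof -
  note fr = frame[OF z] frame'[OF z] X_frame[OF z]
  have "fst x = 0"
  proof (rule orthogonal_to_four_eq_0)
    show "fst (F z) \<noteq> 0" "fst (W z) \<noteq> 0" "fst (n z) \<noteq> 0"
      using fr WW_nz[OF z] by (auto simp: lorentz_def)
    show "fst (X z) \<noteq> 0" using X_frame(4,5)[OF z] \<Delta>_nz[OF z] snd_F1[OF z] by (auto simp: lorentz_def)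
  qed (use fr x in \<open>auto simp: lorentz_def inner_commute\<close>)
  with x(1) show ?thesis by (simp add: prod_eq_iff)
qed

lemma E_skew: "lorentz (E z a) b = - lorentz a (E z b)"
  by (simp add: E_def lorentz_commute)

lemma E_frame:
  assumes "z \<in> S"
  shows "lorentz (F z) (E z q) = 0" "lorentz (X z) (E z q) = 0" "snd (E z q) = - lorentz (W z) q"
  using frame[OF assms] X_frame[OF assms] by (simp_all add: E_def)

lemma E_eq_0_iff:
  assumes "z \<in> S"
  shows "E z q = 0 \<longleftrightarrow> lorentz (F z) q = 0 \<and> lorentz (W z) q = 0"
proof
  assume e: "E z q = 0"
  then have w: "lorentz (W z) q = 0" using E_frame(3)[OF assms, of q] by simp
  with e have "lorentz (F z) q *\<^sub>R W z = 0" by (simp add: E_def)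
  with w WW_nz[OF assms] show "lorentz (F z) q = 0 \<and> lorentz (W z) q = 0" by auto
qed (simp add: E_def)

lemma expand_normal:
  assumes z: "z \<in> S" and x: "lorentz (F z) x = 0" "lorentz (X z) x = 0" "lorentz (W z) x = 0"
  shows "x = lorentz (n z) x *\<^sub>R n z + snd x *\<^sub>R F z"
proof -
  have "x - (lorentz (n z) x *\<^sub>R n z + snd x *\<^sub>R F z) = 0"
    by (rule orthogonal_to_frame_eq_0[OF z])
      (simp_all add: frame[OF z] frame'[OF z] X_frame[OF z] x)
  then show ?thesis by simp
qed

text \<open>The orthogonal complement of \<open>F\<close> and \<open>X\<close> is spanned by \<open>F\<close>, \<open>W\<close> and \<open>n\<close>, that is, by the range of \<open>F \<and> W\<close>
  and the normal. The recursion below keeps the derivatives of the coefficients in this space.\<close>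

lemma expand_range_and_normal:
  assumes z: "z \<in> S" and x: "lorentz (F z) x = 0" "lorentz (X z) x = 0"
  shows "x = snd x *\<^sub>R F z + (lorentz (W z) x / lorentz (W z) (W z)) *\<^sub>R W z + lorentz (n z) x *\<^sub>R n z"
    (is "x = ?y")
proof -
  have "x - ?y = 0"
    by (rule orthogonal_to_frame_eq_0[OF z])
      (simp_all add: frame[OF z] frame'[OF z] X_frame[OF z] x WW_nz[OF z])
  then show ?thesis by simp
qed

lemma X_orthogonal:
  assumes "lorentz (dirD v F z) x = 0" "lorentz (W z) x = 0"
  shows "lorentz (X z) x = 0"
  using assms by (simp add: X_def)

text \<open>A section annihilated by \<open>F \<and> W\<close> is orthogonal to \<open>F\<close> and \<open>W\<close>; differentiating \<open>(F, u) = 0\<close> gives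
  orthogonality to \<open>\<partial>\<^sub>v F\<close>, so only the normal and \<open>F\<close> remain. This describes every leading coefficient.\<close>

lemma normal_if_annihilated:
  assumes d: "\<And>z. z \<in> S \<Longrightarrow> u differentiable (at z)" and E: "\<And>z. z \<in> S \<Longrightarrow> E z (u z) = 0"
    and F: "lorentz (F z) (dirD v u z) = 0" and z: "z \<in> S"
  shows "u z = lorentz (n z) (u z) *\<^sub>R n z + snd (u z) *\<^sub>R F z" "lorentz (F z) (u z) = 0"
proof -
  have fw: "lorentz (F z) (u z) = 0" "lorentz (W z) (u z) = 0"
    using E[OF z] E_eq_0_iff[OF z] by auto
  have "0 = dirD v (\<lambda>y. lorentz (F y) (u y)) z"
    by (rule dirD_eq_0[OF open_S z, symmetric]) (use E E_eq_0_iff in auto)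
  also have "\<dots> = lorentz (dirD v F z) (u z)"
    using F by (simp add: dirD_lorentz[OF F_diff[OF z] d[OF z]])
  finally show "u z = lorentz (n z) (u z) *\<^sub>R n z + snd (u z) *\<^sub>R F z"
    by (intro expand_normal[OF z] fw X_orthogonal) simp
qed (use E[OF z] E_eq_0_iff[OF z] in simp)

text \<open>Induction on the coefficient: once the earlier ones vanish, \<open>u k\<close> is a leading coefficient, so it is
  \<open>\<gamma> n + c F\<close>. Orthogonality to the series \<open>p\<close> gives \<open>\<gamma> = 0\<close>. Then \<open>\<partial>\<^sub>v (c F)\<close> lies in the range of
  \<open>F \<and> W\<close>, which does not contain \<open>\<partial>\<^sub>v F\<close>, so \<open>c = 0\<close>.\<close>

lemma kernel_trivial:
  assumes d: "\<And>k z. z \<in> S \<Longrightarrow> u k differentiable (at z)"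
    and E0: "\<And>z. z \<in> S \<Longrightarrow> E z (u 0 z) = 0"
    and Es: "\<And>k z. z \<in> S \<Longrightarrow> dirD v (u k) z + E z (u (Suc k) z) = 0"
    and P: "\<And>z. z \<in> S \<Longrightarrow> lorentz (F z) (p 0 z) = 0" "\<And>z. z \<in> S \<Longrightarrow> lorentz (n z) (p 0 z) \<noteq> 0"
    and orth: "\<And>k z. z \<in> S \<Longrightarrow> series_prod u p k z = 0"
    and z: "z \<in> S"
  shows "u k z = 0"
  using z
proof (induction k arbitrary: z rule: less_induct)
  case (less k)
  have Ek: "E y (u k y) = 0" if "y \<in> S" for y
  proof (cases k)
    case 0
    then show ?thesis using E0 that by simp
  next
    case (Suc j)
    have "dirD v (u j) y = 0"
      by (rule dirD_eq_0[OF open_S that]) (use less.IH[of j] Suc in auto)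
    then show ?thesis using Es[OF that, of j] Suc by simp
  qed
  have multiple: "u k y = snd (u k y) *\<^sub>R F y" if y: "y \<in> S" for y
  proof -
    have "dirD v (u k) y = - E y (u (Suc k) y)" using Es[OF y] by (simp add: eq_neg_iff_add_eq_0)
    then have eq: "u k y = lorentz (n y) (u k y) *\<^sub>R n y + snd (u k y) *\<^sub>R F y"
      using normal_if_annihilated(1)[OF d Ek _ y] E_frame[OF y] by simp
    have "0 = series_prod u p k y" using orth[OF y] by simp
    also have "\<dots> = (\<Sum>i\<le>k. if i = k then lorentz (u k y) (p 0 y) else 0)"
      unfolding series_prod_def using less.IH[OF _ y] by (intro sum.cong) auto
    also have "\<dots> = lorentz (n y) (u k y) * lorentz (n y) (p 0 y)"
      by (subst eq) (simp add: P(1)[OF y])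
    finally have "lorentz (n y) (u k y) = 0" using P(2)[OF y] by simp
    with eq show ?thesis by simp
  qed
  have "dirD v (u k) z = dirD v (\<lambda>y. snd (u k y) *\<^sub>R F y) z"
    by (rule dirD_cong[OF open_S less.prems multiple d[OF less.prems]])
  also have "\<dots> = snd (u k z) *\<^sub>R dirD v F z + dirD v (\<lambda>y. snd (u k y)) z *\<^sub>R F z"
    by (rule dirD_scaleR[OF _ F_diff[OF less.prems]])
      (use d[OF less.prems, of k] bounded_linear.has_derivative[OF bounded_linear_snd]
        in \<open>unfold differentiable_def, blast\<close>)
  finally have "lorentz (X z) (dirD v (u k) z) = snd (u k z) * \<Delta> z"
    using X_frame[OF less.prems] by simp
  moreover have "dirD v (u k) z = - E z (u (Suc k) z)"
    using Es[OF less.prems] by (simp add: eq_neg_iff_add_eq_0)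
  ultimately have "snd (u k z) = 0" using E_frame[OF less.prems] \<Delta>_nz[OF less.prems] by simp
  with multiple[OF less.prems] show ?case by simp
qed

lemma smooth_F1: "smooth_on S (dirD v F)" by (rule smooth_on_dirD[OF smooth_F])

lemma smooth_\<Delta>: "smooth_on S \<Delta>"
  unfolding \<Delta>_def[abs_def]
  by (intro smooth_on_diff smooth_on_mult smooth_on_lorentz open_S smooth_F1 smooth_W)

lemma smooth_X: "smooth_on S X"
  unfolding X_def[abs_def]
  by (intro smooth_on_diff smooth_on_scaleR smooth_on_lorentz open_S smooth_F1 smooth_W)

text \<open>One step of the recursion. The product of \<open>p\<close> with \<open>\<partial>\<^sub>v F\<close> has to be \<open>\<partial>\<^sub>v \<tau>\<close> for \<open>\<partial>\<^sub>v p\<close> to be orthogonal to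
  \<open>F\<close>. This leaves a multiple of \<open>F\<close> free, which is used to make \<open>\<partial>\<^sub>v p\<close> orthogonal to \<open>X\<close>.\<close>

lemma prescribe_components:
  assumes \<tau>: "smooth_on S \<tau>" and \<omega>: "smooth_on S \<omega>" and \<gamma>: "smooth_on S \<gamma>"
  obtains p where "smooth_on S p"
    "\<And>z. z \<in> S \<Longrightarrow> lorentz (F z) (p z) = \<tau> z" "\<And>z. z \<in> S \<Longrightarrow> lorentz (W z) (p z) = \<omega> z"
    "\<And>z. z \<in> S \<Longrightarrow> lorentz (n z) (p z) = \<gamma> z"
    "\<And>z. z \<in> S \<Longrightarrow> lorentz (F z) (dirD v p z) = 0" "\<And>z. z \<in> S \<Longrightarrow> lorentz (X z) (dirD v p z) = 0"
proof -
  let ?F1 = "dirD v F" and ?T = "dirD v \<tau>"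
  \<comment> \<open>\<open>- e0\<close> pairs to 1 with \<open>F\<close> and to 0 with the rest; the two coefficients of the tangential vectors
    come from Cramer's rule with determinant \<open>\<Delta>\<close>\<close>
  define q where "q z = - \<tau> z *\<^sub>R e0
    + ((?T z * lorentz (W z) (W z) - \<omega> z * lorentz (?F1 z) (W z)) / \<Delta> z) *\<^sub>R ?F1 z
    + ((\<omega> z * lorentz (?F1 z) (?F1 z) - ?T z * lorentz (?F1 z) (W z)) / \<Delta> z) *\<^sub>R W z
    + \<gamma> z *\<^sub>R n z" for z
  \<comment> \<open>\<open>(X, \<partial>\<^sub>v (\<epsilon> F)) = \<epsilon> \<Delta>\<close>, as \<open>(X, F) = 0\<close>\<close>
  define \<epsilon> where "\<epsilon> z = lorentz (X z) (dirD v q z) / \<Delta> z" for z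
  define p where "p z = q z - \<epsilon> z *\<^sub>R F z" for z
  have q: "smooth_on S q"
    unfolding q_def[abs_def]
    by (intro smooth_on_add smooth_on_diff smooth_on_scaleR smooth_on_divide smooth_on_mult
        smooth_on_lorentz smooth_on_minus smooth_on_const open_S smooth_F1 smooth_W smooth_n
        smooth_\<Delta> \<Delta>_nz smooth_on_dirD \<tau> \<omega> \<gamma>)
  have \<epsilon>: "smooth_on S \<epsilon>"
    unfolding \<epsilon>_def[abs_def]
    by (intro smooth_on_divide smooth_on_lorentz smooth_on_dirD q smooth_\<Delta> \<Delta>_nz open_S smooth_X)
  have p: "smooth_on S p"
    unfolding p_def[abs_def] by (intro smooth_on_diff smooth_on_scaleR open_S q \<epsilon> smooth_F)
  note fr = frame frame'
  have pF: "lorentz (F z) (p z) = \<tau> z" if "z \<in> S" for z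
    by (simp add: p_def q_def fr[OF that])
  have pF1: "lorentz (?F1 z) (p z) = ?T z" if "z \<in> S" for z
  proof -
    have "lorentz (?F1 z) (p z) * \<Delta> z = ?T z * \<Delta> z"
      using \<Delta>_nz[OF that] by (simp add: p_def q_def fr[OF that] field_simps) (simp add: \<Delta>_def algebra_simps)
    then show ?thesis using \<Delta>_nz[OF that] by simp
  qed
  have pW: "lorentz (W z) (p z) = \<omega> z" if "z \<in> S" for z
  proof -
    have "lorentz (W z) (p z) * \<Delta> z = \<omega> z * \<Delta> z"
      using \<Delta>_nz[OF that] 
      by (simp add: p_def q_def fr[OF that] field_simps lorentz_commute[of "W z" "?F1 z"])
        (simp add: \<Delta>_def algebra_simps)
    then show ?thesis using \<Delta>_nz[OF that] by simp
  qed
  have pn: "lorentz (n z) (p z) = \<gamma> z" if "z \<in> S" for z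
    by (simp add: p_def q_def fr[OF that])
  have Fp': "lorentz (F z) (dirD v p z) = 0" if "z \<in> S" for z
  proof -
    have "?T z = dirD v (\<lambda>z. lorentz (F z) (p z)) z"
      by (rule dirD_cong[OF open_S that _ smooth_on_differentiable[OF \<tau> that]]) (simp add: pF)
    also have "\<dots> = lorentz (F z) (dirD v p z) + lorentz (?F1 z) (p z)"
      by (rule dirD_lorentz[OF F_diff[OF that] smooth_on_differentiable[OF p that]])
    finally show ?thesis using pF1[OF that] by simp
  qed
  have Xp': "lorentz (X z) (dirD v p z) = 0" if "z \<in> S" for z
  proof -
    note d = smooth_on_differentiable[OF _ that]
    have "dirD v p z = dirD v q z - dirD v (\<lambda>z. \<epsilon> z *\<^sub>R F z) z"
      unfolding p_def[abs_def]
      by (intro dirD_diff d q smooth_on_scaleR open_S \<epsilon> smooth_F)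
    also have "dirD v (\<lambda>z. \<epsilon> z *\<^sub>R F z) z = \<epsilon> z *\<^sub>R ?F1 z + dirD v \<epsilon> z *\<^sub>R F z"
      by (intro dirD_scaleR d \<epsilon> smooth_F)
    finally show ?thesis using \<Delta>_nz[OF that] by (simp add: X_frame[OF that] \<epsilon>_def)
  qed
  show thesis by (rule that[OF p pF pW pn Fp' Xp'])
qed

text \<open>If \<open>p k\<close> is known, the equation \<open>\<partial>\<^sub>v (p k) = - (F \<and> W) (p (k + 1))\<close> gives the products \<open>\<tau>\<close> and \<open>\<omega>\<close> of the
  next coefficient with \<open>F\<close> and \<open>W\<close>, and the condition on \<open>(p, p)\<close> gives its normal component \<open>\<gamma>\<close>. What
  could remain of the equation is a multiple of \<open>n\<close>, which is excluded by differentiating \<open>(p, p) = r\<close>.\<close>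

lemma formal_solution:
  fixes r :: "nat \<Rightarrow> real"
  assumes r: "r 0 > 0"
  obtains p where "\<And>k. smooth_on S (p k)" "\<And>z. z \<in> S \<Longrightarrow> E z (p 0 z) = 0"
    "\<And>k z. z \<in> S \<Longrightarrow> dirD v (p k) z + E z (p (Suc k) z) = 0"
    "\<And>k z. z \<in> S \<Longrightarrow> series_prod p p k z = r k"
    "\<And>z. z \<in> S \<Longrightarrow> lorentz (n z) (p 0 z) = sqrt (r 0)"
proof -
  define \<tau> where "\<tau> f k z = (case k of 0 \<Rightarrow> 0
      | Suc j \<Rightarrow> - (lorentz (W z) (dirD v (f j) z) / lorentz (W z) (W z)))"
    for f :: "nat \<Rightarrow> 'a \<Rightarrow> R41" and k z
  define \<omega> where "\<omega> f k z = (case k of 0 \<Rightarrow> 0 | Suc j \<Rightarrow> snd (dirD v (f j) z))"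
    for f :: "nat \<Rightarrow> 'a \<Rightarrow> R41" and k z
  define \<gamma> where "\<gamma> f k z = (case k of 0 \<Rightarrow> sqrt (r 0)
      | Suc j \<Rightarrow> ((r k - (\<Sum>i\<in>{1..j}. lorentz (f i z) (f (k - i) z))) / 2
          - snd (f 0 z) * \<tau> f k z) / sqrt (r 0))"
    for f :: "nat \<Rightarrow> 'a \<Rightarrow> R41" and k z
  \<comment> \<open>\<open>y\<close> is a correct coefficient number \<open>k\<close> after the coefficients \<open>f i\<close> with \<open>i < k\<close>\<close>
  define Q where "Q f k y \<longleftrightarrow> smooth_on S y \<and> (\<forall>z\<in>S. lorentz (F z) (y z) = \<tau> f k z \<and>
      lorentz (W z) (y z) = \<omega> f k z \<and> lorentz (n z) (y z) = \<gamma> f k z \<and>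
      lorentz (F z) (dirD v y z) = 0 \<and> lorentz (X z) (dirD v y z) = 0)" for f k y
  have "\<exists>p. \<forall>k. Q p k (p k)"
  proof (rule dependent_wf_choice[of less_than])
    show "wf less_than" by simp
  next
    fix f g k y assume fg: "\<And>j. (j, k) \<in> less_than \<Longrightarrow> f j = (g j :: 'a \<Rightarrow> R41)"
    then have fg': "f j = g j" if "j < k" for j using that by simp
    have t: "\<tau> f k z = \<tau> g k z" "\<omega> f k z = \<omega> g k z" for z
      by (cases k; simp add: \<tau>_def \<omega>_def fg')+
    moreover have "\<gamma> f k z = \<gamma> g k z" for z
    proof (cases k)
      case (Suc j)
      have "(\<Sum>i\<in>{1..j}. lorentz (f i z) (f (k - i) z)) = (\<Sum>i\<in>{1..j}. lorentz (g i z) (g (k - i) z))"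
        by (intro sum.cong refl arg_cong2[of _ _ _ _ lorentz] fun_cong[OF fg']) (auto simp: Suc)
      then show ?thesis using fg'[of 0] t(1)[of z] by (simp add: \<gamma>_def Suc)
    qed (simp add: \<gamma>_def)
    ultimately show "Q f k y = Q g k y" by (simp add: Q_def)
  next
    fix k and f :: "nat \<Rightarrow> 'a \<Rightarrow> R41" assume prev: "\<And>j. (j, k) \<in> less_than \<Longrightarrow> Q f j (f j)"
    have sm: "smooth_on S (f j)" if "j < k" for j using prev that by (simp add: Q_def)
    have \<tau>: "smooth_on S (\<tau> f k)"
      unfolding \<tau>_def[abs_def]
      by (cases k) (auto intro!: smooth_on_const smooth_on_minus smooth_on_divide smooth_on_lorentz
          smooth_on_dirD sm WW_nz open_S smooth_W)
    have \<omega>: "smooth_on S (\<omega> f k)"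
      unfolding \<omega>_def[abs_def]
      by (cases k) (auto intro!: smooth_on_const smooth_on_bounded_linear[OF bounded_linear_snd]
          smooth_on_dirD sm open_S)
    have \<gamma>: "smooth_on S (\<gamma> f k)"
    proof (cases k)
      case 0
      then show ?thesis by (simp add: \<gamma>_def[abs_def] smooth_on_const)
    next
      case (Suc j)
      show ?thesis using r
        unfolding \<gamma>_def[abs_def] Suc nat.case
        by (intro smooth_on_divide smooth_on_diff smooth_on_mult smooth_on_sum smooth_on_lorentz
            smooth_on_bounded_linear[OF bounded_linear_snd] smooth_on_const open_S sm \<tau>[unfolded Suc])
          (auto simp: Suc)
    qed
    obtain y where "smooth_on S y"
      "\<And>z. z \<in> S \<Longrightarrow> lorentz (F z) (y z) = \<tau> f k z" "\<And>z. z \<in> S \<Longrightarrow> lorentz (W z) (y z) = \<omega> f k z"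
      "\<And>z. z \<in> S \<Longrightarrow> lorentz (n z) (y z) = \<gamma> f k z"
      "\<And>z. z \<in> S \<Longrightarrow> lorentz (F z) (dirD v y z) = 0" "\<And>z. z \<in> S \<Longrightarrow> lorentz (X z) (dirD v y z) = 0"
      using prescribe_components[OF \<tau> \<omega> \<gamma>] by blast
    then show "\<exists>y. Q f k y" unfolding Q_def by blast
  qed
  then obtain p where Q: "\<And>k. Q p k (p k)" by blast
  have sm: "smooth_on S (p k)" for k using Q by (simp add: Q_def)
  have pF: "lorentz (F z) (p k z) = \<tau> p k z" and pW: "lorentz (W z) (p k z) = \<omega> p k z"
    and pn: "lorentz (n z) (p k z) = \<gamma> p k z" and F': "lorentz (F z) (dirD v (p k) z) = 0"
    and X': "lorentz (X z) (dirD v (p k) z) = 0" if "z \<in> S" for k z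
    using Q that by (auto simp: Q_def)
  have F0: "lorentz (F z) (p 0 z) = 0" and W0: "lorentz (W z) (p 0 z) = 0"
    and n0: "lorentz (n z) (p 0 z) = sqrt (r 0)" if "z \<in> S" for z
    using pF[OF that] pW[OF that] pn[OF that] by (simp_all add: \<tau>_def \<omega>_def \<gamma>_def)
  have E0: "E z (p 0 z) = 0" if "z \<in> S" for z
    using E_eq_0_iff[OF that] F0[OF that] W0[OF that] by simp
  have p0: "p 0 z = sqrt (r 0) *\<^sub>R n z + snd (p 0 z) *\<^sub>R F z" if "z \<in> S" for z
    using normal_if_annihilated(1)[OF smooth_on_differentiable[OF sm] E0 F'[OF that] that] n0[OF that]
    by simp
  have norm: "series_prod p p k z = r k" if z: "z \<in> S" for k z
  proof (cases k)
    case 0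
    have "lorentz (p 0 z) (p 0 z) = sqrt (r 0) * lorentz (n z) (p 0 z) + snd (p 0 z) * lorentz (F z) (p 0 z)"
      by (subst p0[OF z]) simp
    then show ?thesis using n0[OF z] F0[OF z] r by (simp add: series_prod_def 0)
  next
    case (Suc j)
    have "lorentz (p 0 z) (p k z) = sqrt (r 0) * \<gamma> p k z + snd (p 0 z) * \<tau> p k z"
      by (subst p0[OF z]) (simp add: pF[OF z] pn[OF z])
    also have "\<dots> = (r k - (\<Sum>i\<in>{1..j}. lorentz (p i z) (p (k - i) z))) / 2"
      using r by (simp add: \<gamma>_def Suc)
    finally have *: "2 * lorentz (p 0 z) (p k z) + (\<Sum>i\<in>{1..j}. lorentz (p i z) (p (k - i) z)) = r k"
      by simp
    have "{..k} = insert 0 (insert k {1..j})" using Suc by auto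
    then have "series_prod p p k z = lorentz (p 0 z) (p k z) + (lorentz (p k z) (p 0 z)
        + (\<Sum>i\<in>{1..j}. lorentz (p i z) (p (k - i) z)))"
      using Suc by (simp add: series_prod_def)
    then show ?thesis using * by (simp add: lorentz_commute)
  qed
  have residual: "dirD v (p k) z + E z (p (Suc k) z) = lorentz (n z) (dirD v (p k) z) *\<^sub>R n z"
    if z: "z \<in> S" for k z
    by (subst expand_range_and_normal[OF z F'[OF z] X'[OF z]])
      (simp add: E_def pF[OF z] pW[OF z] \<tau>_def \<omega>_def)
  have eqn: "dirD v (p k) z + E z (p (Suc k) z) = 0" if z: "z \<in> S" for k z
  proof (induction k rule: less_induct)
    case (less k)
    have "(\<Sum>i\<le>k. lorentz (dirD v (p i) z) (p (k - i) z)) = 0"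
      by (rule series_prod_deriv[OF open_S z smooth_on_differentiable[OF sm z] norm])
    \<comment> \<open>the terms \<open>(E (p i), p (k + 1 - i))\<close> with \<open>i \<le> k + 1\<close> cancel by skewness, and the one with
      \<open>i = 0\<close> vanishes\<close>
    moreover have "(\<Sum>i\<le>k. lorentz (E z (p (Suc i) z)) (p (k - i) z)) = 0"
      using series_prod_skew[OF E_skew, of z "\<lambda>i. p i z" "Suc k"] E0[OF z]
      by (simp add: sum.atMost_Suc_shift del: sum.atMost_Suc)
    ultimately have "0 = (\<Sum>i\<le>k. lorentz (dirD v (p i) z + E z (p (Suc i) z)) (p (k - i) z))"
      by (simp add: sum.distrib)
    also have "\<dots> = (\<Sum>i\<le>k. if i = k then lorentz (dirD v (p k) z + E z (p (Suc k) z)) (p 0 z) else 0)"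
      using less.IH by (intro sum.cong) (auto simp del: lorentz_linear(1))
    also have "\<dots> = lorentz (n z) (dirD v (p k) z) * sqrt (r 0)"
      unfolding residual[OF z] by (simp add: n0[OF z])
    finally show ?case unfolding residual[OF z] using r by simp
  qed
  show thesis by (rule that[OF sm E0 eqn norm n0])
qed

end

section \<open>Isothermic surfaces in a chart\<close>

lemma inner_rotate: "(x::complex) \<bullet> (\<i> * x) = 0" "(\<i> * x) \<bullet> (\<i> * y) = x \<bullet> y"
  by (simp_all add: inner_complex_def)

text \<open>An element of \<open>\<Lambda> \<and> \<Lambda>\<^sup>\<bottom>\<close> is \<open>f \<and> w\<close> with a single vector \<open>w\<close>, which modulo \<open>f\<close> can be taken with last
  coordinate 0. It is then minus the value at \<open>e0\<close>, and so depends smoothly on the element.\<close>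

lemma wedge_space_null_line:
  assumes f: "snd f = 1" "lorentz f f = 0"
    and B: "B \<in> wedge_space (span {f}) (lorentz_perp (span {f}))"
  shows "snd (blinfun_apply B e0) = 0" "lorentz f (blinfun_apply B e0) = 0"
    "blinfun_apply B q = lorentz (blinfun_apply B e0) q *\<^sub>R f - lorentz f q *\<^sub>R blinfun_apply B e0"
proof -
  let ?P = "\<lambda>B. snd (blinfun_apply B e0) = 0 \<and> lorentz f (blinfun_apply B e0) = 0 \<and>
    (\<forall>q. blinfun_apply B q = lorentz (blinfun_apply B e0) q *\<^sub>R f - lorentz f q *\<^sub>R blinfun_apply B e0)"
  have "?P B"
    using B unfolding wedge_space_def
  proof (induction rule: span_induct)
    show "subspace {B. ?P B}"
      by (rule subspaceI, simp, simp add: plus_blinfun.rep_eq algebra_simps)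
        (simp add: scaleR_blinfun.rep_eq scaleR_right_diff_distrib)
  next
    fix C assume "C \<in> {wedge u w |u w. u \<in> span {f} \<and> w \<in> lorentz_perp (span {f})}"
    then obtain c w where C: "C = wedge (c *\<^sub>R f) w" and w: "w \<in> lorentz_perp (span {f})"
      by (auto simp: span_singleton)
    have "lorentz f w = 0" using w span_base[of f "{f}"] by (simp add: lorentz_perp_def)
    then show "?P C" unfolding C wedge_apply using f by (simp add: algebra_simps)
  qed
  then show "snd (blinfun_apply B e0) = 0" "lorentz f (blinfun_apply B e0) = 0"
    "blinfun_apply B q = lorentz (blinfun_apply B e0) q *\<^sub>R f - lorentz f q *\<^sub>R blinfun_apply B e0"
    by blast+
qed

text \<open>An isothermic surface in one chart: \<open>F\<close> is the section of \<open>\<Lambda>\<close> with last coordinate 1, and \<open>\<eta> v\<close> is the value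
  of the form on the constant vector field \<open>v\<close>.\<close>

locale isothermic_chart =
  fixes U :: "complex set" and F :: "complex \<Rightarrow> R41" and \<eta> :: "complex \<Rightarrow> complex \<Rightarrow> R41 \<Rightarrow>\<^sub>L R41"
  assumes open_U: "open U"
    and smooth_F: "smooth_on U F" and snd_F: "z \<in> U \<Longrightarrow> snd (F z) = 1"
    and FF: "z \<in> U \<Longrightarrow> lorentz (F z) (F z) = 0"
    and conf: "z \<in> U \<Longrightarrow> \<exists>m>0. \<forall>v w. lorentz (dirD v F z) (dirD w F z) = m * (v \<bullet> w)"
    and smooth_\<eta>: "smooth_on U (\<eta> v)"
    and linear_\<eta>: "z \<in> U \<Longrightarrow> linear (\<lambda>v. \<eta> v z)"
    and \<eta>_wedge: "z \<in> U \<Longrightarrow> \<eta> v z \<in> wedge_space (span {F z}) (lorentz_perp (span {F z}))"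
    and closed: "z \<in> U \<Longrightarrow> dirD v (\<eta> w) z = dirD w (\<eta> v) z"
begin

definition W :: "complex \<Rightarrow> complex \<Rightarrow> R41" where
  "W v z = - blinfun_apply (\<eta> v z) e0"

lemma F_diff: "z \<in> U \<Longrightarrow> F differentiable (at z)"
  using smooth_F smooth_on_differentiable by blast

lemma snd_F1: assumes "z \<in> U" shows "snd (dirD v F z) = 0"
  using dirD_eq_0[OF open_U assms, of "\<lambda>z. snd (F z)" 1 v] snd_F
    dirD_bounded_linear[OF bounded_linear_snd F_diff[OF assms], of v] by simp

lemma FF1: assumes "z \<in> U" shows "lorentz (F z) (dirD v F z) = 0"
  using dirD_eq_0[OF open_U assms, of "\<lambda>z. lorentz (F z) (F z)" 0 v] FF
    dirD_lorentz[OF F_diff[OF assms] F_diff[OF assms], of v] by (simp add: lorentz_commute)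

lemma snd_W: "z \<in> U \<Longrightarrow> snd (W v z) = 0"
  and FW: "z \<in> U \<Longrightarrow> lorentz (F z) (W v z) = 0"
  using wedge_space_null_line(1,2)[OF snd_F FF \<eta>_wedge] by (simp_all add: W_def)

lemma \<eta>_eq:
  assumes "z \<in> U"
  shows "blinfun_apply (\<eta> v z) q = lorentz (F z) q *\<^sub>R W v z - lorentz (W v z) q *\<^sub>R F z"
  by (rule trans[OF wedge_space_null_line(3)[OF snd_F FF \<eta>_wedge]]) (simp_all add: W_def assms)

lemma smooth_apply:
  assumes "smooth_on S B" "smooth_on S f" "open S"
  shows "smooth_on S (\<lambda>z. blinfun_apply (B z) (f z))"
  by (rule smooth_on_bilinear[OF bounded_bilinear_blinfun_apply assms(3,1,2)])

lemma smooth_W: "smooth_on U (W v)"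
  unfolding W_def[abs_def]
  by (intro smooth_on_minus smooth_apply smooth_\<eta> smooth_on_const open_U)

lemma W_diff: "z \<in> U \<Longrightarrow> W v differentiable (at z)"
  using smooth_W smooth_on_differentiable by blast

lemma linear_W: "z \<in> U \<Longrightarrow> linear (\<lambda>v. W v z)"
  unfolding W_def
  by (auto intro!: linearI simp: linear_add[OF linear_\<eta>] linear_scale[OF linear_\<eta>]
      plus_blinfun.rep_eq scaleR_blinfun.rep_eq)

lemma linear_F1: "z \<in> U \<Longrightarrow> linear (\<lambda>v. dirD v F z)"
  by (rule dirD_linear[OF F_diff])

lemma dirD_\<eta>_apply:
  assumes "z \<in> U"
  shows "dirD v (\<lambda>z. blinfun_apply (\<eta> w z) q) z = blinfun_apply (dirD v (\<eta> w) z) q"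
  using dirD_bilinear[OF bounded_bilinear_blinfun_apply, of "\<eta> w" z "\<lambda>_. q"]
    smooth_on_differentiable[OF smooth_\<eta> assms] by simp

text \<open>Closedness of \<open>\<eta>\<close>, evaluated at the constant vector \<open>e0\<close>.\<close>

lemma W_closed:
  assumes "z \<in> U"
  shows "dirD v (W w) z = dirD w (W v) z"
proof -
  have "dirD v (W w) z = - blinfun_apply (dirD v (\<eta> w) z) e0" for v w
  proof -
    have "(\<lambda>z. blinfun_apply (\<eta> w z) e0) differentiable (at z)"
      using smooth_on_differentiable[OF smooth_apply[OF smooth_\<eta> smooth_on_const open_U] assms] .
    then have "dirD v (\<lambda>z. - blinfun_apply (\<eta> w z) e0) z = - dirD v (\<lambda>z. blinfun_apply (\<eta> w z) e0) z"
      by (rule dirD_bounded_linear[OF bounded_linear_minus[OF bounded_linear_ident]])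
    then show ?thesis unfolding W_def[abs_def] dirD_\<eta>_apply[OF assms] .
  qed
  then show ?thesis by (simp only: closed[OF assms, of v w])
qed

text \<open>Differentiate \<open>\<eta>(w) = F \<and> W w\<close> in direction \<open>v\<close> and exchange \<open>v\<close> and \<open>w\<close>. By \<open>W_closed\<close> the terms
  \<open>F \<and> \<partial>\<^sub>v (W w)\<close> cancel, and \<open>\<partial>\<^sub>v F \<and> W w = \<partial>\<^sub>w F \<and> W v\<close> remains.\<close>

lemma tangential_closed:
  assumes z: "z \<in> U"
  shows "lorentz (dirD v F z) q *\<^sub>R W w z - lorentz (W w z) q *\<^sub>R dirD v F z
       = lorentz (dirD w F z) q *\<^sub>R W v z - lorentz (W v z) q *\<^sub>R dirD w F z"
proof -
  have lor: "dirD v (\<lambda>z. lorentz (f z) q) z = lorentz (dirD v f z) q"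
    "(\<lambda>z. lorentz (f z) q) differentiable (at z)"
    if "f differentiable (at z)" for f :: "complex \<Rightarrow> R41" and v
    using dirD_bilinear[OF bounded_bilinear_lorentz that, of "\<lambda>_. q"]
      differentiable_bilinear[OF bounded_bilinear_lorentz that, of "\<lambda>_. q"] by simp_all
  have "blinfun_apply (dirD v (\<eta> w) z) q =
      lorentz (F z) q *\<^sub>R dirD v (W w) z + lorentz (dirD v F z) q *\<^sub>R W w z
      - (lorentz (W w z) q *\<^sub>R dirD v F z + lorentz (dirD v (W w) z) q *\<^sub>R F z)" for v w
  proof -
    have "blinfun_apply (dirD v (\<eta> w) z) q = dirD v (\<lambda>z. blinfun_apply (\<eta> w z) q) z"
      using dirD_\<eta>_apply[OF z] by simp
    also have "\<dots> = dirD v (\<lambda>z. lorentz (F z) q *\<^sub>R W w z - lorentz (W w z) q *\<^sub>R F z) z"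
      by (rule dirD_cong[OF open_U z \<eta>_eq smooth_on_differentiable[OF
              smooth_apply[OF smooth_\<eta> smooth_on_const open_U] z]])
    also have "\<dots> = dirD v (\<lambda>z. lorentz (F z) q *\<^sub>R W w z) z - dirD v (\<lambda>z. lorentz (W w z) q *\<^sub>R F z) z"
      by (intro dirD_diff differentiable_bilinear[OF bounded_bilinear_scaleR] lor W_diff F_diff z)
    finally show ?thesis
      by (simp add: dirD_scaleR[OF lor(2) W_diff] dirD_scaleR[OF lor(2) F_diff] lor W_diff F_diff z)
  qed
  from this[of v w] this[of w v] show ?thesis
    unfolding closed[OF z, of v w] W_closed[OF z, of v w] by (simp add: algebra_simps)
qed

abbreviation \<mu> :: "complex \<Rightarrow> complex \<Rightarrow> real" where
  "\<mu> v z \<equiv> lorentz (dirD v F z) (dirD v F z)"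

lemma conformal:
  assumes "z \<in> U" "v \<noteq> 0"
  shows "\<mu> v z > 0" "lorentz (dirD v F z) (dirD (\<i> * v) F z) = 0" "\<mu> (\<i> * v) z = \<mu> v z"
proof -
  from conf[OF assms(1)] obtain m where m: "m > 0"
    "\<And>v w. lorentz (dirD v F z) (dirD w F z) = m * (v \<bullet> w)" by blast
  then show "\<mu> v z > 0" "lorentz (dirD v F z) (dirD (\<i> * v) F z) = 0" "\<mu> (\<i> * v) z = \<mu> v z"
    using assms(2) by (auto simp: inner_rotate)
qed

text \<open>The \<open>F\<close>-component of \<open>W_closed\<close>.\<close>

lemma W_symmetric:
  assumes z: "z \<in> U"
  shows "lorentz (W v z) (dirD w F z) = lorentz (W w z) (dirD v F z)"
proof -
  have *: "lorentz (F z) (dirD v (W w) z) = - lorentz (dirD v F z) (W w z)" for v w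
    using dirD_eq_0[OF open_U z, of "\<lambda>z. lorentz (F z) (W w z)" 0 v] FW
      dirD_lorentz[OF F_diff[OF z] W_diff[OF z], of v] by simp
  show ?thesis using *[of v w] *[of w v] W_closed[OF z, of v w] by (simp add: lorentz_commute)
qed

text \<open>Apply \<open>\<partial>\<^sub>v F \<and> W (\<i> v) = \<partial>\<^sub>\<i>\<^sub>v F \<and> W v\<close> to \<open>\<partial>\<^sub>\<i>\<^sub>v F\<close>. Together with \<open>W_symmetric\<close> this says that
  \<open>(W v, \<partial>\<^sub>w F)\<close> is a trace-free symmetric form on the tangent plane, the real part of a quadratic
  differential.\<close>

lemma W_tangential:
  assumes z: "z \<in> U" and v: "v \<noteq> 0"
  shows "\<mu> v z *\<^sub>R W v z = lorentz (W v z) (dirD v F z) *\<^sub>R dirD v F z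
      + lorentz (W v z) (dirD (\<i> * v) F z) *\<^sub>R dirD (\<i> * v) F z"
    "lorentz (W (\<i> * v) z) (dirD (\<i> * v) F z) = - lorentz (W v z) (dirD v F z)"
proof -
  let ?w = "\<i> * v"
  note c = conformal[OF z v] lorentz_commute[of "dirD ?w F z" "dirD v F z"]
  have "\<mu> v z *\<^sub>R W v z = - lorentz (W ?w z) (dirD ?w F z) *\<^sub>R dirD v F z
      + lorentz (W v z) (dirD ?w F z) *\<^sub>R dirD ?w F z"
    using tangential_closed[OF z, of v "dirD ?w F z" ?w] c by (simp add: algebra_simps)
  moreover from arg_cong[OF this, of "lorentz (dirD v F z)"]
  have "\<mu> v z * (lorentz (W ?w z) (dirD ?w F z) + lorentz (W v z) (dirD v F z)) = 0"
    using c by (simp add: lorentz_commute algebra_simps)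
  then show tr: "lorentz (W ?w z) (dirD ?w F z) = - lorentz (W v z) (dirD v F z)"
    using c(1) by simp
  ultimately show "\<mu> v z *\<^sub>R W v z = lorentz (W v z) (dirD v F z) *\<^sub>R dirD v F z
      + lorentz (W v z) (dirD ?w F z) *\<^sub>R dirD ?w F z" by simp
qed

text \<open>\<open>Q dz\<^sup>2\<close> is the quadratic differential with real part \<open>(W v, \<partial>\<^sub>v F)\<close>.\<close>

definition Q :: "complex \<Rightarrow> complex" where
  "Q z = Complex (lorentz (W 1 z) (dirD 1 F z)) (- lorentz (W 1 z) (dirD \<i> F z))"

lemma Q_eq_0_iff:
  assumes z: "z \<in> U"
  shows "Q z = 0 \<longleftrightarrow> (\<forall>v. \<eta> v z = 0)"
proof
  assume Q: "Q z = 0"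
  then have PR: "lorentz (W 1 z) (dirD 1 F z) = 0" "lorentz (W 1 z) (dirD \<i> F z) = 0"
    by (simp_all add: Q_def complex_eq_iff)
  have W1: "W 1 z = 0" using W_tangential[OF z, of 1] conformal[OF z, of 1] PR by simp
  have "lorentz (W \<i> z) (dirD \<i> F z) = 0" using W_tangential(2)[OF z, of 1] PR by simp
  moreover have "lorentz (W \<i> z) (dirD (\<i> * \<i>) F z) = 0"
    using W_symmetric[OF z, of \<i> "\<i> * \<i>"] linear_neg[OF linear_W[OF z], of 1] W1 by simp
  ultimately have Wi: "W \<i> z = 0" using W_tangential(1)[OF z, of \<i>] conformal[OF z, of \<i>] by simp
  show "\<forall>v. \<eta> v z = 0"
  proof
    fix v
    have "v = Re v *\<^sub>R 1 + Im v *\<^sub>R \<i>" by (simp add: complex_eq_iff)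
    from arg_cong[OF this, of "\<lambda>v. W v z"]
    have "W v z = W (Re v *\<^sub>R 1 + Im v *\<^sub>R \<i>) z" .
    also have "\<dots> = 0"
      unfolding linear_add[OF linear_W[OF z]] linear_scale[OF linear_W[OF z]] W1 Wi by simp
    finally show "\<eta> v z = 0" using \<eta>_eq[OF z, of v] by (intro blinfun_eqI) simp
  qed
next
  assume "\<forall>v. \<eta> v z = 0"
  then show "Q z = 0" by (simp add: Q_def W_def complex_eq_iff)
qed

text \<open>The Cauchy-Riemann equations are the two components of \<open>W_closed\<close> along the surface. The second
  derivatives of \<open>F\<close> that appear cancel by the differentiated conformality relations \<open>c0\<close> and \<open>c1\<close>.\<close>

lemma Q_holomorphic: "Q holomorphic_on U"
proof -
  have "Q field_differentiable (at z)" if z: "z \<in> U" for z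
  proof -
    let ?F = "\<lambda>v. dirD v F z" and ?FF = "\<lambda>v w. dirD v (dirD w F) z"
    let ?q = "\<lambda>v w z. lorentz (W v z) (dirD w F z)"
    have F1d: "dirD v F differentiable (at z)" for v
      by (rule smooth_on_differentiable[OF smooth_on_dirD[OF smooth_F] z])
    have qd: "?q v w differentiable (at z)" for v w
      by (rule differentiable_bilinear[OF bounded_bilinear_lorentz W_diff[OF z] F1d])
    have q': "dirD u (?q v w) z = lorentz (W v z) (?FF u w) + lorentz (dirD u (W v) z) (?F w)" for u v w
      by (rule dirD_lorentz[OF W_diff[OF z] F1d])
    have sym: "?FF \<i> 1 = ?FF 1 \<i>" by (rule dirD_commute[OF open_U smooth_F z])
    have m0: "dirD u (\<lambda>z. lorentz (dirD 1 F z) (dirD \<i> F z)) z = 0" for u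
      by (rule dirD_eq_0[OF open_U z, of _ 0]) (use conformal(2)[of _ 1] in simp)
    have m1: "dirD u (\<lambda>z. lorentz (dirD 1 F z) (dirD 1 F z) - lorentz (dirD \<i> F z) (dirD \<i> F z)) z = 0" for u
      by (rule dirD_eq_0[OF open_U z, of _ 0]) (use conformal(3)[of _ 1] in simp)
    have c0: "lorentz (?F 1) (?FF u \<i>) = - lorentz (?FF u 1) (?F \<i>)" for u
      using m0[of u] dirD_lorentz[OF F1d F1d, of u 1 \<i>] by simp
    have c1: "lorentz (?F 1) (?FF u 1) = lorentz (?F \<i>) (?FF u \<i>)" for u
      using m1[of u] dirD_lorentz[OF F1d F1d, of u] 
        dirD_diff[OF differentiable_bilinear[OF bounded_bilinear_lorentz F1d F1d]
          differentiable_bilinear[OF bounded_bilinear_lorentz F1d F1d], of u 1 1 \<i> \<i>]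
      by (simp add: lorentz_commute)
    let ?P = "?q 1 1 z" and ?R = "?q 1 \<i> z" and ?m = "\<mu> 1 z"
    have m: "?m > 0" using conformal(1)[OF z, of 1] by simp
    have W1: "?m *\<^sub>R W 1 z = ?P *\<^sub>R ?F 1 + ?R *\<^sub>R ?F \<i>"
      using W_tangential(1)[OF z, of 1] by simp
    have neg: "?F (- 1) = - ?F 1" "W (- 1) z = - W 1 z"
      using linear_neg[OF linear_F1[OF z], of 1] linear_neg[OF linear_W[OF z], of 1] by simp_all
    have Wi: "?m *\<^sub>R W \<i> z = ?R *\<^sub>R ?F 1 - ?P *\<^sub>R ?F \<i>"
      using W_tangential[OF z, of \<i>] W_tangential(2)[OF z, of 1] conformal(3)[OF z, of 1]
        W_symmetric[OF z, of \<i> 1] neg by simp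
    have W1': "?m * lorentz (W 1 z) x = ?P * lorentz (?F 1) x + ?R * lorentz (?F \<i>) x" for x
      using arg_cong[OF W1, of "\<lambda>y. lorentz y x"] by simp
    have Wi': "?m * lorentz (W \<i> z) x = ?R * lorentz (?F 1) x - ?P * lorentz (?F \<i>) x" for x
      using arg_cong[OF Wi, of "\<lambda>y. lorentz y x"] by simp
    have "?m * lorentz (W \<i> z) (?FF 1 1) = ?m * lorentz (W 1 z) (?FF \<i> 1)"
      unfolding W1' Wi' using c0[of 1] c1[of 1] sym by (simp add: lorentz_commute)
    then have e1: "lorentz (W \<i> z) (?FF 1 1) = lorentz (W 1 z) (?FF \<i> 1)" using m by simp
    have "?m * lorentz (W \<i> z) (?FF 1 \<i>) = ?m * lorentz (W 1 z) (?FF \<i> \<i>)"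
      unfolding W1' Wi' using c0[of \<i>] c1[of \<i>] sym by (simp add: lorentz_commute)
    then have e2: "lorentz (W \<i> z) (?FF 1 \<i>) = lorentz (W 1 z) (?FF \<i> \<i>)" using m by simp
    have "dirD 1 (?q 1 \<i>) z = dirD 1 (?q \<i> 1) z"
      by (rule dirD_cong[OF open_U z W_symmetric qd])
    also have "\<dots> = dirD \<i> (?q 1 1) z"
      unfolding q' using e1 W_closed[OF z, of 1 \<i>] by simp
    finally have cr1: "dirD 1 (?q 1 \<i>) z = dirD \<i> (?q 1 1) z" .
    have "dirD 1 (?q 1 1) z = dirD 1 (\<lambda>z. - ?q \<i> \<i> z) z"
      by (rule dirD_cong[OF open_U z _ qd]) (use W_tangential(2)[of _ 1] in simp)
    also have "\<dots> = - dirD 1 (?q \<i> \<i>) z"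
      using dirD_bounded_linear[OF bounded_linear_minus[OF bounded_linear_ident] qd] by simp
    also have "\<dots> = - dirD \<i> (?q 1 \<i>) z"
      unfolding q' using e2 W_closed[OF z, of 1 \<i>] by simp
    finally have cr2: "dirD 1 (?q 1 1) z = - dirD \<i> (?q 1 \<i>) z" .
    define D where "D = Complex (dirD 1 (?q 1 1) z) (- dirD 1 (?q 1 \<i>) z)"
    have lin: "dirD h (?q 1 w) z = Re h * dirD 1 (?q 1 w) z + Im h * dirD \<i> (?q 1 w) z" for h w
    proof -
      have "h = Re h *\<^sub>R 1 + Im h *\<^sub>R \<i>" by (simp add: complex_eq_iff)
      from arg_cong[OF this, of "\<lambda>h. dirD h (?q 1 w) z"]
      have "dirD h (?q 1 w) z = dirD (Re h *\<^sub>R 1 + Im h *\<^sub>R \<i>) (?q 1 w) z" .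
      then show ?thesis
        by (simp add: linear_add[OF dirD_linear[OF qd]] linear_scale[OF dirD_linear[OF qd]])
    qed
    have der: "(Q has_derivative (\<lambda>h. Complex (dirD h (?q 1 1) z) (- dirD h (?q 1 \<i>) z))) (at z)"
      unfolding Q_def[abs_def] Complex_eq
      by (intro has_derivative_add has_derivative_mult_right has_derivative_minus
          bounded_linear.has_derivative[OF bounded_linear_of_real] has_derivative_dirD qd)
    have "Complex (dirD h (?q 1 1) z) (- dirD h (?q 1 \<i>) z) = D * h" for h
      unfolding lin[of h 1] lin[of h \<i>] by (simp add: complex_eq_iff D_def cr1 cr2)
    with der have "(Q has_derivative (*) D) (at z)" by simp
    then show ?thesis unfolding field_differentiable_def has_field_derivative_def by blast
  qed
  then show ?thesis
    by (simp add: holomorphic_on_def field_differentiable_at_within)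
qed

end

section \<open>Conserved quantities in a chart\<close>

context isothermic_chart
begin

text \<open>The unit normal of the surface in the unit sphere. The cross product has length \<open>\<mu> 1\<close>, by Lagrange's
  identity and conformality.\<close>

definition nrm :: "complex \<Rightarrow> R41" where
  "nrm z = ((1 / \<mu> 1 z) *\<^sub>R cross4 (fst (F z)) (fst (dirD 1 F z)) (fst (dirD \<i> F z)), 0)"

lemma smooth_nrm: "smooth_on U nrm"
proof -
  have emb: "bounded_linear (\<lambda>a :: real ^ 4. (a, 0 :: real))"
    by (intro bounded_linear_Pair bounded_linear_ident bounded_linear_zero)
  show ?thesis unfolding nrm_def[abs_def]
    by (intro smooth_on_bounded_linear[OF emb open_U] smooth_on_scaleR smooth_on_divide smooth_on_cross4
        smooth_on_lorentz smooth_on_const smooth_on_dirD smooth_F open_U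
        smooth_on_bounded_linear[OF bounded_linear_fst])
      (use conformal(1)[of _ 1] in force)
qed

lemma complex_basis: "v = Re v *\<^sub>R 1 + Im v *\<^sub>R \<i>" by (simp add: complex_eq_iff)

lemma F1_basis: "z \<in> U \<Longrightarrow> dirD v F z = Re v *\<^sub>R dirD 1 F z + Im v *\<^sub>R dirD \<i> F z"
  using arg_cong[OF complex_basis[of v], of "\<lambda>v. dirD v F z"]
  by (simp only: linear_add[OF linear_F1] linear_scale[OF linear_F1])

lemma nrm_frame:
  assumes z: "z \<in> U"
  shows "snd (nrm z) = 0" "lorentz (F z) (nrm z) = 0" "lorentz (nrm z) (dirD v F z) = 0"
    "lorentz (nrm z) (nrm z) = 1" "lorentz (nrm z) (W v z) = 0"
proof -
  let ?y = "fst (F z)" and ?a = "fst (dirD 1 F z)" and ?b = "fst (dirD \<i> F z)"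
  note c = conformal[OF z, of 1]
  have in_R4: "?a \<bullet> ?a = \<mu> 1 z" "?b \<bullet> ?b = \<mu> 1 z" "?a \<bullet> ?b = 0"
    using c snd_F1[OF z] by (simp_all add: lorentz_def)
  have y: "?y \<bullet> ?y = 1" "?y \<bullet> ?a = 0" "?y \<bullet> ?b = 0"
    using FF[OF z] FF1[OF z] snd_F1[OF z] snd_F[OF z] by (simp_all add: lorentz_def)
  show sn: "snd (nrm z) = 0" by (simp add: nrm_def)
  show "lorentz (F z) (nrm z) = 0"
    by (simp add: lorentz_def nrm_def cross4_orthogonal)
  have "lorentz (nrm z) (dirD 1 F z) = 0" "lorentz (nrm z) (dirD \<i> F z) = 0"
    by (simp_all add: lorentz_def nrm_def cross4_orthogonal inner_commute[of "cross4 _ _ _"])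
  then show nF: "lorentz (nrm z) (dirD v F z) = 0" for v
    by (subst F1_basis[OF z]) simp
  have "cross4 ?y ?a ?b \<bullet> cross4 ?y ?a ?b = \<mu> 1 z * \<mu> 1 z"
    unfolding cross4_gram by (simp add: in_R4 y)
  then show "lorentz (nrm z) (nrm z) = 1"
    using c(1) by (simp add: lorentz_def nrm_def)
  show "lorentz (nrm z) (W v z) = 0"
  proof (cases "v = 0")
    case False
    have "\<mu> v z * lorentz (nrm z) (W v z) = 0"
      using arg_cong[OF W_tangential(1)[OF z False], of "lorentz (nrm z)"] nF by simp
    then show ?thesis using conformal(1)[OF z False] by simp
  qed (simp add: linear_0[OF linear_W[OF z]])
qed

text \<open>The Gram determinant of \<open>\<partial>\<^sub>v F\<close> and \<open>W v\<close> is the square of \<open>(W v, \<partial>\<^sub>\<i>\<^sub>v F)\<close>.\<close>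

lemma direction_frame:
  assumes S: "open S" "S \<subseteq> U" and v: "v \<noteq> 0"
    and nz: "\<And>z. z \<in> S \<Longrightarrow> lorentz (W v z) (dirD (\<i> * v) F z) \<noteq> 0"
  shows "direction_frame S v F (W v) nrm"
proof
  fix z assume "z \<in> S"
  then have z: "z \<in> U" using S by auto
  let ?m = "\<mu> v z" and ?p = "lorentz (W v z) (dirD v F z)" and ?r = "lorentz (W v z) (dirD (\<i> * v) F z)"
  have "?m * lorentz (W v z) (W v z) = ?p * ?p + ?r * ?r"
    using arg_cong[OF W_tangential(1)[OF z v], of "lorentz (W v z)"] by simp
  then show "lorentz (dirD v F z) (dirD v F z) * lorentz (W v z) (W v z)
       - lorentz (dirD v F z) (W v z) * lorentz (dirD v F z) (W v z) \<noteq> 0"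
    using nz[OF \<open>z \<in> S\<close>] by (simp add: lorentz_commute[of "dirD v F z" "W v z"])
qed (use S smooth_on_subset[OF smooth_F S(2)] smooth_on_subset[OF smooth_W S(2)]
    smooth_on_subset[OF smooth_nrm S(2)] snd_F snd_W FF FW nrm_frame in auto)

text \<open>\<open>(W v, \<partial>\<^sub>\<i>\<^sub>v F)\<close> is \<open>- Im (Q v\<^sup>2)\<close>. If it vanishes for \<open>v = 1\<close>, then \<open>Q\<close> is real and \<open>v = 1 + \<i>\<close> with
  \<open>v\<^sup>2 = 2 \<i>\<close> works.\<close>

lemma exists_direction:
  assumes z: "z \<in> U" and Q: "Q z \<noteq> 0"
  obtains v where "v \<noteq> 0" "lorentz (W v z) (dirD (\<i> * v) F z) \<noteq> 0"
proof (cases "Im (Q z) = 0")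
  case False
  then show ?thesis using that[of 1] by (simp add: Q_def)
next
  case True
  then have P: "lorentz (W 1 z) (dirD 1 F z) \<noteq> 0" and R: "lorentz (W 1 z) (dirD \<i> F z) = 0"
    using Q by (simp_all add: Q_def complex_eq_iff)
  have "\<i> * (1 + \<i>) = \<i> + - 1" by (simp add: algebra_simps)
  then have "dirD (\<i> * (1 + \<i>)) F z = dirD \<i> F z - dirD 1 F z"
    by (simp add: linear_add[OF linear_F1[OF z]] linear_diff[OF linear_F1[OF z]])
  moreover have "W (1 + \<i>) z = W 1 z + W \<i> z" by (rule linear_add[OF linear_W[OF z]])
  ultimately have "lorentz (W (1 + \<i>) z) (dirD (\<i> * (1 + \<i>)) F z) = - 2 * lorentz (W 1 z) (dirD 1 F z)"
    using R W_tangential(2)[OF z, of 1] W_symmetric[OF z, of \<i> 1] by simp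
  moreover have "1 + \<i> \<noteq> 0" by (simp add: complex_eq_iff)
  ultimately show ?thesis using that[of "1 + \<i>"] P by simp
qed

lemma direction_frame_near:
  assumes z: "z \<in> U" and Q: "Q z \<noteq> 0" and T: "open T" "z \<in> T"
  obtains v S where "open S" "z \<in> S" "S \<subseteq> U" "S \<subseteq> T" "direction_frame S v F (W v) nrm"
proof -
  obtain v where v: "v \<noteq> 0" "lorentz (W v z) (dirD (\<i> * v) F z) \<noteq> 0"
    using exists_direction[OF z Q] .
  define S where "S = (U \<inter> (\<lambda>z. lorentz (W v z) (dirD (\<i> * v) F z)) -` (- {0})) \<inter> T"
  have "continuous_on U (\<lambda>z. lorentz (W v z) (dirD (\<i> * v) F z))"
    by (intro smooth_on_continuous smooth_on_lorentz smooth_W smooth_on_dirD smooth_F open_U)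
  then have S: "open S" unfolding S_def
    by (intro open_Int[OF _ T(1)] continuous_open_preimage open_U) auto
  have "direction_frame S v F (W v) nrm"
    by (rule direction_frame[OF S _ v(1)]) (auto simp: S_def)
  then show ?thesis using that[OF S] z v T by (auto simp: S_def)
qed

definition conserved :: "complex set \<Rightarrow> (nat \<Rightarrow> complex \<Rightarrow> R41) \<Rightarrow> bool" where
  "conserved S p \<longleftrightarrow> (\<forall>k. \<forall>z\<in>S. p k differentiable (at z)) \<and>
     (\<forall>z\<in>S. \<forall>v. blinfun_apply (\<eta> v z) (p 0 z) = 0) \<and>
     (\<forall>k. \<forall>z\<in>S. \<forall>v. dirD v (p k) z + blinfun_apply (\<eta> v z) (p (Suc k) z) = 0)"

lemma conserved_subset: "conserved S p \<Longrightarrow> T \<subseteq> S \<Longrightarrow> conserved T p"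
  unfolding conserved_def by blast

lemma conservedD:
  assumes "conserved S p" "z \<in> S"
  shows "p k differentiable (at z)" "blinfun_apply (\<eta> v z) (p 0 z) = 0"
    "dirD v (p k) z + blinfun_apply (\<eta> v z) (p (Suc k) z) = 0"
  using assms unfolding conserved_def by blast+

lemma frame_E:
  assumes "direction_frame S v F (W v) nrm" "z \<in> S" "S \<subseteq> U"
  shows "direction_frame.E F (W v) z q = blinfun_apply (\<eta> v z) q"
proof -
  have "z \<in> U" using assms by auto
  then show ?thesis unfolding direction_frame.E_def[OF assms(1)] by (rule \<eta>_eq[symmetric])
qed

text \<open>The leading coefficient is \<open>\<gamma> n + c F\<close>, and \<open>F\<close> is null and orthogonal to \<open>n\<close>.\<close>

lemma conserved_leading_term:
  assumes S: "open S" "S \<subseteq> U" and z: "z \<in> S" "Q z \<noteq> 0" and p: "conserved S p"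
  shows "lorentz (p 0 z) (p 0 z) = (lorentz (nrm z) (p 0 z))\<^sup>2"
proof -
  obtain v T where T: "open T" "z \<in> T" "T \<subseteq> U" "T \<subseteq> S" "direction_frame T v F (W v) nrm"
    by (rule direction_frame_near[OF subsetD[OF S(2) z(1)] z(2) S(1) z(1)])
  interpret direction_frame T v F "W v" nrm by fact
  note E = frame_E[OF T(5) _ T(3)]
  have "dirD v (p 0) z = - E z (p 1 z)"
    using conservedD(3)[OF p z(1), of v 0] by (simp add: E[OF T(2)] eq_neg_iff_add_eq_0)
  then have "lorentz (F z) (dirD v (p 0) z) = 0" using E_frame(1)[OF T(2)] by simp
  moreover have "E y (p 0 y) = 0" "p 0 differentiable (at y)" if "y \<in> T" for y
    using conservedD[OF p subsetD[OF T(4) that]] by (simp_all add: E[OF that])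
  ultimately have *: "p 0 z = lorentz (nrm z) (p 0 z) *\<^sub>R nrm z + snd (p 0 z) *\<^sub>R F z"
    "lorentz (F z) (p 0 z) = 0"
    using normal_if_annihilated[of "p 0", OF _ _ _ T(2)] by blast+
  have "lorentz (p 0 z) (p 0 z) =
    lorentz (lorentz (nrm z) (p 0 z) *\<^sub>R nrm z + snd (p 0 z) *\<^sub>R F z) (p 0 z)"
    using *(1) by (rule arg_cong)
  then show ?thesis using *(2) by (simp add: power2_eq_square)
qed

text \<open>\<open>(p - q, p + q) = (p, p) - (q, q) = 0\<close>, so \<open>kernel_trivial\<close> applies to \<open>p - q\<close>.\<close>

lemma conserved_unique:
  assumes S: "open S" "S \<subseteq> U" and z: "z \<in> S" "Q z \<noteq> 0"
    and p: "conserved S p" and q: "conserved S q"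
    and norm: "\<And>k z. z \<in> S \<Longrightarrow> series_prod p p k z = series_prod q q k z"
    and nz: "\<And>z. z \<in> S \<Longrightarrow> lorentz (nrm z) (p 0 z + q 0 z) \<noteq> 0"
  shows "p k z = q k z"
proof -
  obtain v T where T: "open T" "z \<in> T" "T \<subseteq> U" "T \<subseteq> S" "direction_frame T v F (W v) nrm"
    by (rule direction_frame_near[OF subsetD[OF S(2) z(1)] z(2) S(1) z(1)])
  interpret direction_frame T v F "W v" nrm by fact
  note E = frame_E[OF T(5) _ T(3)]
  let ?u = "\<lambda>k z. p k z - q k z" and ?s = "\<lambda>k z. p k z + q k z"
  note pD = conservedD[OF p subsetD[OF T(4)]] and qD = conservedD[OF q subsetD[OF T(4)]]
  have p0: "E y (p 0 y) = 0" "E y (q 0 y) = 0" if "y \<in> T" for y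
    using pD(2)[OF that] qD(2)[OF that] by (simp_all add: E[OF that])
  have pE: "dirD v (p k) y + E y (p (Suc k) y) = 0" "dirD v (q k) y + E y (q (Suc k) y) = 0"
    if "y \<in> T" for k y
    using pD(3)[OF that] qD(3)[OF that] by (simp_all add: E[OF that])
  have E_diff: "E y (a - b) = E y a - E y b" for y a b
    by (simp add: E_def algebra_simps)
  have "?u k z = 0"
  proof (rule kernel_trivial[where u = ?u and p = ?s])
    show "?u k differentiable (at y)" if "y \<in> T" for k y
      using pD(1)[OF that] qD(1)[OF that] by (intro differentiable_diff)
    show "E y (?u 0 y) = 0" if "y \<in> T" for y
      using p0[OF that] by (simp add: E_diff)
    show "dirD v (?u k) y + E y (?u (Suc k) y) = 0" if "y \<in> T" for k y
    proof -
      have "dirD v (?u k) y + E y (?u (Suc k) y) =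
          (dirD v (p k) y + E y (p (Suc k) y)) - (dirD v (q k) y + E y (q (Suc k) y))"
        by (simp add: E_diff dirD_diff[OF pD(1) qD(1)] that)
      then show ?thesis using pE[OF that] by simp
    qed
    show "lorentz (F y) (?s 0 y) = 0" if "y \<in> T" for y
      using p0[OF that] E_eq_0_iff[OF that] by simp
    show "lorentz (nrm y) (?s 0 y) \<noteq> 0" if "y \<in> T" for y
      using nz that T by blast
    show "series_prod ?u ?s k y = 0" if "y \<in> T" for k y
    proof -
      have "series_prod ?u ?s k y = series_prod p p k y - series_prod q q k y
          + (series_prod p q k y - series_prod q p k y)"
        unfolding series_prod_def sum_subtractf[symmetric] sum.distrib[symmetric]
        by (simp add: algebra_simps)
      then show ?thesis using norm[of y k] that T series_prod_commute[of p q k y] by auto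
    qed
  qed fact
  then show ?thesis by simp
qed

lemma \<eta>_commute:
  assumes "z \<in> U"
  shows "blinfun_apply (\<eta> v z) (blinfun_apply (\<eta> w z) q) = blinfun_apply (\<eta> w z) (blinfun_apply (\<eta> v z) q)"
  by (simp add: \<eta>_eq[OF assms] FF[OF assms] FW[OF assms] lorentz_commute[of "W _ z" "F z"]
      lorentz_commute[of "W v z" "W w z"])

lemma \<eta>_skew: "z \<in> U \<Longrightarrow> lorentz (blinfun_apply (\<eta> v z) a) b = - lorentz a (blinfun_apply (\<eta> v z) b)"
  by (simp add: \<eta>_eq lorentz_commute)

text \<open>The series \<open>u = D\<^sub>w p\<close> satisfies \<open>D\<^sub>v u = D\<^sub>w D\<^sub>v p = 0\<close>, as \<open>\<eta>\<close> is closed and its values commute, and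
  \<open>(u, p)\<close> is half the derivative of the constant \<open>(p, p)\<close>. So \<open>kernel_trivial\<close> applies to \<open>u\<close>.\<close>

lemma one_direction_suffices:
  assumes fr: "direction_frame S v F (W v) nrm" and S: "S \<subseteq> U"
    and sm: "\<And>k. smooth_on S (p k)"
    and E0: "\<And>z. z \<in> S \<Longrightarrow> blinfun_apply (\<eta> v z) (p 0 z) = 0"
    and Es: "\<And>k z. z \<in> S \<Longrightarrow> dirD v (p k) z + blinfun_apply (\<eta> v z) (p (Suc k) z) = 0"
    and norm: "\<And>k z. z \<in> S \<Longrightarrow> series_prod p p k z = r k"
    and nz: "\<And>z. z \<in> S \<Longrightarrow> lorentz (nrm z) (p 0 z) \<noteq> 0"
  shows "conserved S p"
proof -
  interpret direction_frame S v F "W v" nrm by fact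
  note E = frame_E[OF fr _ S]
  note d = smooth_on_differentiable[OF sm] and open_S = open_S
  have \<eta>s: "smooth_on S (\<eta> w)" for w using smooth_on_subset[OF smooth_\<eta> S] .
  have \<eta>d: "dirD v' (\<lambda>z. blinfun_apply (\<eta> w z) (p k z)) z =
      blinfun_apply (\<eta> w z) (dirD v' (p k) z) + blinfun_apply (dirD v' (\<eta> w) z) (p k z)"
    if "z \<in> S" for v' w k z
    by (rule dirD_bilinear[OF bounded_bilinear_blinfun_apply smooth_on_differentiable[OF \<eta>s that] d[OF that]])
  have \<eta>a: "smooth_on S (\<lambda>z. blinfun_apply (\<eta> w z) (p k z))" for w k
    by (rule smooth_apply[OF \<eta>s sm open_S])
  have main: "(case k of 0 \<Rightarrow> 0 | Suc j \<Rightarrow> dirD w (p j) z) + blinfun_apply (\<eta> w z) (p k z) = 0"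
    if z: "z \<in> S" for k z w
  proof -
    \<comment> \<open>the coefficient of \<open>t\<close> to the power \<open>1 - k\<close> in \<open>D\<^sub>w p\<close>\<close>
    define u where "u k z = (case k of 0 \<Rightarrow> 0 | Suc j \<Rightarrow> dirD w (p j) z) + blinfun_apply (\<eta> w z) (p k z)"
      for k z
    have u0: "u 0 = (\<lambda>z. blinfun_apply (\<eta> w z) (p 0 z))"
      and uS: "u (Suc k) = (\<lambda>z. dirD w (p k) z + blinfun_apply (\<eta> w z) (p (Suc k) z))" for k
      by (simp_all add: u_def fun_eq_iff)
    have us: "smooth_on S (u k)" for k
      by (cases k) (auto simp: u0 uS intro!: smooth_on_add smooth_on_dirD sm \<eta>a open_S)
    have "u k z = 0"
    proof (rule kernel_trivial[where u = u and p = p])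
      show "u k differentiable (at y)" if "y \<in> S" for k y
        by (rule smooth_on_differentiable[OF us that])
      show "E y (u 0 y) = 0" if y: "y \<in> S" for y
        by (simp add: E[OF y] u0 \<eta>_commute[OF subsetD[OF S y], of v w] E0[OF y])
      show "dirD v (u k) y + E y (u (Suc k) y) = 0" if y: "y \<in> S" for k y
      proof -
        note yU = subsetD[OF S y]
        have step: "dirD v (\<lambda>z. blinfun_apply (\<eta> w z) (p k z)) y
            + blinfun_apply (\<eta> v y) (dirD w (p k) y + blinfun_apply (\<eta> w y) (p (Suc k) y))
          = dirD w (\<lambda>z. blinfun_apply (\<eta> v z) (p k z)) y" for k
        proof -
          have "blinfun_apply (\<eta> w y) (dirD v (p k) y + blinfun_apply (\<eta> v y) (p (Suc k) y)) = 0"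
            using Es[OF y] by simp
          then show ?thesis
            by (simp add: \<eta>d[OF y] closed[OF yU, of v w] \<eta>_commute[OF yU, of v w] blinfun.add_right
                algebra_simps)
        qed
        show ?thesis
        proof (cases k)
          case 0
          have "dirD w (\<lambda>z. blinfun_apply (\<eta> v z) (p 0 z)) y = 0"
            by (rule dirD_eq_0[OF open_S y]) (rule E0)
          then show ?thesis using step[of 0] by (simp add: 0 u0 uS E[OF y])
        next
          case (Suc j)
          have "dirD v (u k) y = dirD v (dirD w (p j)) y
              + dirD v (\<lambda>z. blinfun_apply (\<eta> w z) (p k z)) y"
            unfolding Suc uS
            by (rule dirD_add) (intro smooth_on_differentiable[OF _ y] smooth_on_dirD sm \<eta>a)+
          also have "dirD v (dirD w (p j)) y = dirD w (dirD v (p j)) y"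
            by (rule dirD_commute[OF open_S sm y])
          finally have "dirD v (u k) y + E y (u (Suc k) y) = dirD w (dirD v (p j)) y
              + dirD w (\<lambda>z. blinfun_apply (\<eta> v z) (p k z)) y"
            using step[of k] by (simp add: E[OF y] uS add.assoc)
          also have "\<dots> = dirD w (\<lambda>z. dirD v (p j) z + blinfun_apply (\<eta> v z) (p k z)) y"
            by (rule dirD_add[symmetric]) (intro smooth_on_differentiable[OF _ y] smooth_on_dirD sm \<eta>a)+
          also have "\<dots> = 0"
            by (rule dirD_eq_0[OF open_S y]) (simp add: Es Suc)
          finally show ?thesis .
        qed
      qed
      show "lorentz (F y) (p 0 y) = 0" if "y \<in> S" for y
        using E0[OF that] E_eq_0_iff[OF that] unfolding E[OF that] by blast
      show "lorentz (nrm y) (p 0 y) \<noteq> 0" if "y \<in> S" for y using nz[OF that] .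
      show "series_prod u p k y = 0" if y: "y \<in> S" for k y
      proof -
        have skew: "(\<Sum>i\<le>k. lorentz (blinfun_apply (\<eta> w y) (p i y)) (p (k - i) y)) = 0"
          by (rule series_prod_skew[OF \<eta>_skew[OF subsetD[OF S y]]])
        show ?thesis
        proof (cases k)
          case 0
          then show ?thesis using skew by (simp add: series_prod_def u0)
        next
          case (Suc j)
          have "(\<Sum>i\<le>j. lorentz (dirD w (p i) y) (p (j - i) y)) = 0"
            by (rule series_prod_deriv[OF open_S y d[OF y] norm])
          then have "series_prod u p k y = (\<Sum>i\<le>k. lorentz (blinfun_apply (\<eta> w y) (p i y)) (p (k - i) y))"
            by (simp add: series_prod_def Suc sum.atMost_Suc_shift u0 uS sum.distrib del: sum.atMost_Suc)
          then show ?thesis using skew by simp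
        qed
      qed
    qed fact
    then show ?thesis unfolding u_def .
  qed
  show ?thesis
    unfolding conserved_def using d main[where k = 0] main[where k = "Suc _"] by simp
qed

lemma conserved_exists:
  fixes r :: "nat \<Rightarrow> real"
  assumes z: "z \<in> U" "Q z \<noteq> 0" and r: "r 0 > 0"
  obtains S p where "open S" "z \<in> S" "S \<subseteq> U" "\<And>k. smooth_on S (p k)" "conserved S p"
    "\<And>k z. z \<in> S \<Longrightarrow> series_prod p p k z = r k"
    "\<And>z. z \<in> S \<Longrightarrow> lorentz (nrm z) (p 0 z) = sqrt (r 0)"
proof -
  obtain v S where S: "open S" "z \<in> S" "S \<subseteq> U" "S \<subseteq> UNIV" and fr: "direction_frame S v F (W v) nrm"
    by (rule direction_frame_near[OF z open_UNIV UNIV_I])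
  interpret direction_frame S v F "W v" nrm by fact
  note E = frame_E[OF fr _ S(3)]
  show thesis
  proof (rule formal_solution[of r, OF r])
    fix p assume p: "\<And>k. smooth_on S (p k)" "\<And>z. z \<in> S \<Longrightarrow> E z (p 0 z) = 0"
      "\<And>k z. z \<in> S \<Longrightarrow> dirD v (p k) z + E z (p (Suc k) z) = 0"
      "\<And>k z. z \<in> S \<Longrightarrow> series_prod p p k z = r k"
      "\<And>z. z \<in> S \<Longrightarrow> lorentz (nrm z) (p 0 z) = sqrt (r 0)"
    have "conserved S p"
    proof (rule one_direction_suffices[OF fr S(3) p(1) _ _ p(4)])
      fix z k assume z: "z \<in> S"
      show "blinfun_apply (\<eta> v z) (p 0 z) = 0" using p(2)[OF z] unfolding E[OF z] .
      show "dirD v (p k) z + blinfun_apply (\<eta> v z) (p (Suc k) z) = 0"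
        using p(3)[OF z] unfolding E[OF z] .
      show "lorentz (nrm z) (p 0 z) \<noteq> 0" using p(5)[OF z] r by simp
    qed
    then show thesis by (rule that[OF S(1-3) p(1) _ p(4,5)])
  qed
qed

end

section \<open>Removing the zeros\<close>

text \<open>A separation of the complement would extend to one of the whole space: near every point the complement
  of \<open>Z\<close> lies on one side only, and density of the complement keeps the extended sides disjoint.\<close>

lemma connected_Compl_if_locally:
  fixes Z :: "'a::topological_space set"
  assumes conn: "connected (UNIV :: 'a set)"
    and loc: "\<And>x. \<exists>B. open B \<and> x \<in> B \<and> connected (B - Z)"
    and dense: "\<And>B. open B \<Longrightarrow> B \<subseteq> Z \<Longrightarrow> B = {}"
  shows "connected (- Z)"
proof (rule connectedI)
  fix M N assume MN: "open M" "open N" "M \<inter> - Z \<noteq> {}" "N \<inter> - Z \<noteq> {}" "M \<inter> N \<inter> - Z = {}" "- Z \<subseteq> M \<union> N"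
  define ext where "ext M = \<Union>{G. open G \<and> G - Z \<subseteq> M}" for M
  have extI: "x \<in> ext M" if "open G" "x \<in> G" "G - Z \<subseteq> M" for x G M
    using that unfolding ext_def by blast
  have "x \<in> ext M \<union> ext N" for x
  proof -
    obtain B where B: "open B" "x \<in> B" "connected (B - Z)" using loc by blast
    have "M \<inter> (B - Z) = {} \<or> N \<inter> (B - Z) = {}"
      using connectedD[OF B(3) MN(1,2)] MN(5,6) by blast
    then have "B - Z \<subseteq> M \<or> B - Z \<subseteq> N" using MN(6) by blast
    then show ?thesis using extI[OF B(1,2)] by blast
  qed
  then have cover: "UNIV \<subseteq> ext M \<union> ext N" by blast
  have disjoint: "ext M \<inter> ext N = {}"
  proof -
    have "G \<inter> H = {}" if "open G" "G - Z \<subseteq> M" "open H" "H - Z \<subseteq> N" for G H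
      using that MN(5) by (intro dense open_Int) auto
    then show ?thesis unfolding ext_def by blast
  qed
  have opn: "open (ext M)" for M unfolding ext_def by blast
  obtain x y where "x \<in> M" "y \<in> N" using MN(3,4) by blast
  then have "x \<in> ext M" "y \<in> ext N" using extI MN(1,2) by blast+
  then show False using connectedD[OF conn opn opn, of M N] cover disjoint by auto
qed

section \<open>Isothermic surfaces\<close>

locale isothermic =
  fixes A :: "('a::t2_space) chart set" and \<Lambda> :: "'a \<Rightarrow> R41 set"
    and \<eta> :: "('a, R41 \<Rightarrow>\<^sub>L R41) form1"
  assumes riemann: "riemann_surface A" and isothermic: "isothermic_surface A \<Lambda> \<eta>"
begin

abbreviation coord_range :: "'a chart \<Rightarrow> complex set" where "coord_range c \<equiv> snd c ` fst c"

lemma chart: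
  assumes "c \<in> A"
  shows "open (fst c)" "open (coord_range c)" "homeomorphism (fst c) (coord_range c) (snd c) (chart_inv c)"
  using riemann assms unfolding riemann_surface_def by blast+

lemma chart_inv_coord: "c \<in> A \<Longrightarrow> x \<in> fst c \<Longrightarrow> chart_inv c (snd c x) = x"
  using chart(3) homeomorphism_apply1 by blast

lemma coord_chart_inv: "c \<in> A \<Longrightarrow> z \<in> coord_range c \<Longrightarrow> snd c (chart_inv c z) = z"
  using chart(3) homeomorphism_apply2 by blast

lemma chart_inv_in: "c \<in> A \<Longrightarrow> z \<in> coord_range c \<Longrightarrow> chart_inv c z \<in> fst c"
  by (metis chart_inv_coord imageE)

lemma chart_image_eq:
  assumes "c \<in> A"
  shows "chart_image c V = coord_range c \<inter> chart_inv c -` V"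
  unfolding chart_image_def using chart_inv_coord[OF assms] by (auto simp: image_iff)

lemma chart_image_UNIV: "chart_image c UNIV = coord_range c"
  by (simp add: chart_image_def)

lemma open_chart_image:
  assumes c: "c \<in> A" and "open V"
  shows "open (chart_image c V)"
  unfolding chart_image_eq[OF c]
  using homeomorphism_cont2[OF chart(3)[OF c]] assms chart(2)[OF c]
  by (intro continuous_open_preimage) auto

lemma open_chart_inv_image:
  assumes c: "c \<in> A" and G: "open G" "G \<subseteq> coord_range c"
  shows "open (chart_inv c ` G)"
proof -
  have "chart_inv c ` G = fst c \<inter> snd c -` G"
    using G chart_inv_coord[OF c] coord_chart_inv[OF c] chart_inv_in[OF c] by (auto simp: image_iff) force
  then show ?thesis
    using continuous_open_preimage[OF homeomorphism_cont1[OF chart(3)[OF c]] chart(1)[OF c] G(1)] by simp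
qed

lemma ex_chart: obtains c where "c \<in> A" "x \<in> fst c"
  using riemann unfolding riemann_surface_def by blast

text \<open>The section of \<open>\<Lambda>\<close> with last coordinate 1, that is, the surface as a map into the unit sphere
  of \<open>\<real>\<^sup>4\<close>.\<close>

definition \<sigma> :: "'a \<Rightarrow> R41" where
  "\<sigma> x = (SOME v. v \<in> \<Lambda> x \<and> snd v = 1)"

lemma \<sigma>_local:
  assumes "local_section A \<Lambda> V s" "x \<in> V"
  shows "snd (s x) \<noteq> 0" "\<sigma> x = (1 / snd (s x)) *\<^sub>R s x" "lorentz (s x) (s x) = 0" "\<Lambda> x = span {s x}"
proof -
  from assms have s: "s x \<noteq> 0" "lorentz (s x) (s x) = 0" and L: "\<Lambda> x = span {s x}"
    unfolding local_section_def light_cone_def by auto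
  show nz: "snd (s x) \<noteq> 0"
  proof
    assume "snd (s x) = 0"
    then have "s x = 0" using s(2) by (simp add: lorentz_def prod_eq_iff)
    with s show False by simp
  qed
  have "(v \<in> \<Lambda> x \<and> snd v = 1) \<longleftrightarrow> v = (1 / snd (s x)) *\<^sub>R s x" for v
    using nz by (auto simp: L span_singleton eq_divide_eq)
  then show "\<sigma> x = (1 / snd (s x)) *\<^sub>R s x" unfolding \<sigma>_def by simp
qed (use assms in \<open>auto simp: local_section_def light_cone_def\<close>)

lemma ex_local_section: obtains V s where "x \<in> V" "local_section A \<Lambda> V s"
  using isothermic unfolding isothermic_surface_def conformal_immersion_def smooth_null_line_bundle_def
  by blast

lemma \<sigma>_null: "snd (\<sigma> x) = 1" "lorentz (\<sigma> x) (\<sigma> x) = 0" "\<Lambda> x = span {\<sigma> x}"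
proof -
  obtain V s where "x \<in> V" "local_section A \<Lambda> V s" by (rule ex_local_section)
  note s = \<sigma>_local[OF this(2,1)]
  show "snd (\<sigma> x) = 1" "lorentz (\<sigma> x) (\<sigma> x) = 0" using s by auto
  have "span {(1 / snd (s x)) *\<^sub>R s x} = span {s x}"
    using s(1) by (intro span_image_scale[of "{s x}" "\<lambda>_. 1 / snd (s x)", simplified]) auto
  then show "\<Lambda> x = span {\<sigma> x}" using s by simp
qed

lemma smooth_\<sigma>:
  assumes c: "c \<in> A"
  shows "smooth_on (coord_range c) (\<sigma> \<circ> chart_inv c)"
proof (rule smooth_on_local)
  fix z assume z: "z \<in> coord_range c"
  obtain V s where V: "chart_inv c z \<in> V" "local_section A \<Lambda> V s" by (rule ex_local_section)
  let ?T = "chart_image c V"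
  have "open V" and s: "smooth_on ?T (s \<circ> chart_inv c)"
    using V(2) c unfolding local_section_def smooth_fun_on_def by auto
  have T: "open ?T" by (rule open_chart_image[OF c \<open>open V\<close>])
  have inV: "chart_inv c y \<in> V" if "y \<in> ?T" for y using that by (simp add: chart_image_eq[OF c])
  have "smooth_on ?T (\<lambda>y. (1 / snd ((s \<circ> chart_inv c) y)) *\<^sub>R (s \<circ> chart_inv c) y)"
    using \<sigma>_local(1)[OF V(2) inV]
    by (intro smooth_on_scaleR smooth_on_divide smooth_on_const T s
        smooth_on_bounded_linear[OF bounded_linear_snd]) simp
  then have "smooth_on ?T (\<sigma> \<circ> chart_inv c)"
    by (rule smooth_on_cong[OF T]) (simp add: \<sigma>_local(2)[OF V(2) inV])
  then show "\<exists>T. open T \<and> z \<in> T \<and> smooth_on T (\<sigma> \<circ> chart_inv c)"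
    using T V(1) z by (auto simp: chart_image_eq[OF c])
qed

abbreviation F where "F c \<equiv> \<sigma> \<circ> chart_inv c"
abbreviation H where "H c \<equiv> \<lambda>v z. \<eta> c (chart_inv c z) v"

lemma \<sigma>_section: "local_section A \<Lambda> UNIV \<sigma>"
proof -
  have "\<sigma> x \<in> light_cone" for x
    using \<sigma>_null[of x] by (auto simp: light_cone_def)
  then show ?thesis
    unfolding local_section_def smooth_fun_on_def chart_image_UNIV using smooth_\<sigma> \<sigma>_null(3) by blast
qed

lemma isothermic_chart:
  assumes c: "c \<in> A"
  shows "isothermic_chart (coord_range c) (F c) (H c)"
proof (rule isothermic_chart.intro)
  have val: "\<eta> c x v \<in> wedge_space (\<Lambda> x) (lorentz_perp (\<Lambda> x))" if "x \<in> fst c" for x v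
    using isothermic c that unfolding isothermic_surface_def by blast
  have form: "smooth_one_form A \<eta>" "closed_one_form A \<eta>"
    using isothermic unfolding isothermic_surface_def by blast+
  show "open (coord_range c)" by (rule chart(2)[OF c])
  show "smooth_on (coord_range c) (F c)" by (rule smooth_\<sigma>[OF c])
  show "smooth_on (coord_range c) (H c v)" for v
    using form(1) c unfolding smooth_one_form_def chart_image_UNIV by blast
  fix z v w assume z: "z \<in> coord_range c"
  note x = chart_inv_in[OF c z] and zx = coord_chart_inv[OF c z]
  show "snd (F c z) = 1" "lorentz (F c z) (F c z) = 0" by (simp_all add: \<sigma>_null)
  show "linear (\<lambda>v. H c v z)" using form(1) c x unfolding smooth_one_form_def by blast
  show "H c v z \<in> wedge_space (span {F c z}) (lorentz_perp (span {F c z}))"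
    using val[OF x] by (simp add: \<sigma>_null(3))
  show "dirD v (H c w) z = dirD w (H c v) z"
    using form(2) c x zx unfolding closed_one_form_def diff_def dirD_def o_def by force
  have "\<forall>c\<in>A. \<forall>x \<in> UNIV \<inter> fst c. \<exists>m>0. \<forall>v w. lorentz (diff c \<sigma> x v) (diff c \<sigma> x w) = m * (v \<bullet> w)"
    using isothermic \<sigma>_section unfolding isothermic_surface_def conformal_immersion_def by blast
  then show "\<exists>m>0. \<forall>v w. lorentz (dirD v (F c) z) (dirD w (F c) z) = m * (v \<bullet> w)"
    using c x zx unfolding diff_def dirD_def by force
qed

abbreviation Q where "Q c \<equiv> isothermic_chart.Q (F c) (H c)"

lemma in_zero_set_iff:
  assumes c: "c \<in> A" and z: "z \<in> coord_range c"
  shows "chart_inv c z \<in> zero_set A \<eta> \<longleftrightarrow> Q c z = 0"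
proof -
  let ?x = "chart_inv c z"
  note x = chart_inv_in[OF c z]
  have "?x \<in> zero_set A \<eta> \<longleftrightarrow> (\<forall>v. \<eta> c ?x v = 0)"
  proof
    assume "\<forall>v. \<eta> c ?x v = 0"
    moreover have "\<eta> d ?x v = \<eta> c ?x (diff d (snd c) ?x v)" if "d \<in> A" "?x \<in> fst d" for d v
      using isothermic c x that unfolding isothermic_surface_def smooth_one_form_def by blast
    ultimately show "?x \<in> zero_set A \<eta>" unfolding zero_set_def by auto
  qed (use c x in \<open>auto simp: zero_set_def\<close>)
  then show ?thesis using isothermic_chart.Q_eq_0_iff[OF isothermic_chart[OF c] z] by simp
qed

text \<open>By analytic continuation of \<open>Q\<close> the interior of the zero set is closed, so it is empty or everything,
  and the latter is excluded by \<open>\<eta> \<noteq> 0\<close>.\<close>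

lemma zero_set_interior_empty:
  assumes "open B" "B \<subseteq> zero_set A \<eta>"
  shows "B = {}"
proof -
  let ?I = "interior (zero_set A \<eta>)"
  have "x \<in> ?I" if x: "x \<in> closure ?I" for x
  proof -
    obtain c where c: "c \<in> A" "x \<in> fst c" by (rule ex_chart)
    obtain e where e: "e > 0" "ball (snd c x) e \<subseteq> coord_range c"
      using chart(2)[OF c(1)] c(2) by (meson imageI openE)
    let ?b = "ball (snd c x) e"
    let ?N = "chart_inv c ` ?b"
    have N: "open ?N" by (rule open_chart_inv_image[OF c(1) open_ball e(2)])
    have xN: "x \<in> ?N" using chart_inv_coord[OF c] e(1) by (metis centre_in_ball imageI)
    then obtain y where y: "y \<in> ?N" "y \<in> ?I"
      using x N by (metis closure_iff_nhds_not_empty dual_order.refl disjoint_iff)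
    let ?G = "chart_image c ?I \<inter> ?b"
    have "Q c w = 0" if w: "w \<in> ?b" for w
    proof (rule analytic_continuation_open[where g = "\<lambda>_. 0" and f = "Q c" and s = ?G and s' = ?b, OF _ _ _ _ _ _ _ _ w])
      show "open ?G" using open_chart_image[OF c(1) open_interior] by blast
      show "?G \<noteq> {}" using y e(2) by (auto simp: chart_image_eq[OF c(1)])
      show "Q c holomorphic_on ?b"
        using isothermic_chart.Q_holomorphic[OF isothermic_chart[OF c(1)]] e(2) holomorphic_on_subset by blast
      show "Q c z = 0" if "z \<in> ?G" for z
        using that in_zero_set_iff[OF c(1)] interior_subset e(2) by (auto simp: chart_image_eq[OF c(1)])
    qed auto
    then have "?N \<subseteq> zero_set A \<eta>" using in_zero_set_iff[OF c(1)] e(2) by auto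
    then show "x \<in> ?I" using N xN by (meson interiorI)
  qed
  then have "closed ?I" by (metis closure_subset closed_closure subsetI subset_antisym)
  then have "?I = {} \<or> ?I = UNIV"
    using riemann connected_clopen[of "UNIV :: 'a set"] unfolding riemann_surface_def by auto
  moreover have "?I \<noteq> UNIV"
    using isothermic interior_subset[of "zero_set A \<eta>"] unfolding isothermic_surface_def by auto
  ultimately show ?thesis using assms interior_maximal by blast
qed

text \<open>Zeros of the holomorphic function \<open>Q\<close> are isolated, and a punctured disc is connected.\<close>

lemma connected_minus_zero_set: "connected (- zero_set A \<eta>)"
proof (rule connected_Compl_if_locally[OF _ _ zero_set_interior_empty])
  show "connected (UNIV :: 'a set)" using riemann unfolding riemann_surface_def by blast
  fix x :: 'a
  obtain c where c: "c \<in> A" "x \<in> fst c" by (rule ex_chart)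
  let ?z = "snd c x" and ?U = "coord_range c"
  have z: "?z \<in> ?U" using c by blast
  have hol: "Q c holomorphic_on ?U" by (rule isothermic_chart.Q_holomorphic[OF isothermic_chart[OF c(1)]])
  obtain e where e: "e > 0" "ball ?z e \<subseteq> ?U"
    using chart(2)[OF c(1)] z by (meson openE)
  obtain r where r: "r > 0" "ball ?z r \<subseteq> ?U" "\<And>w. w \<in> ball ?z r - {?z} \<Longrightarrow> Q c w \<noteq> 0"
  proof (cases "Q c ?z = 0")
    case True
    have "chart_inv c ` ball ?z e \<noteq> {}" using e(1) by simp
    then have "\<not> chart_inv c ` ball ?z e \<subseteq> zero_set A \<eta>"
      using zero_set_interior_empty[OF open_chart_inv_image[OF c(1) open_ball e(2)]] by blast
    then obtain w where w: "w \<in> ball ?z e" "Q c w \<noteq> 0"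
      using in_zero_set_iff[OF c(1)] e(2) by blast
    have "?z \<in> ball ?z e" using e(1) by simp
    then show thesis
      by (rule isolated_zeros[OF holomorphic_on_subset[OF hol e(2)] open_ball connected_ball _ True w])
        (use e(2) that in blast)
  next
    case False
    have "open (?U \<inter> Q c -` (- {0}))"
      using holomorphic_on_imp_continuous_on[OF hol] chart(2)[OF c(1)]
      by (intro continuous_open_preimage) auto
    then obtain r where "r > 0" "ball ?z r \<subseteq> ?U \<inter> Q c -` (- {0})"
      by (rule openE[of _ ?z]) (use z False in auto)
    then show thesis by (intro that[of r]) auto
  qed
  let ?B = "chart_inv c ` ball ?z r"
  let ?P = "if Q c ?z = 0 then ball ?z r - {?z} else ball ?z r"
  have "connected ?P" by (simp add: connected_punctured_ball)
  moreover have "?P \<subseteq> ?U" using r(2) by (auto split: if_splits)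
  ultimately have "connected (chart_inv c ` ?P)"
    using homeomorphism_cont2[OF chart(3)[OF c(1)]] continuous_on_subset connected_continuous_image by blast
  moreover have "?B - zero_set A \<eta> = chart_inv c ` ?P"
  proof -
    have "w \<in> ?P \<longleftrightarrow> w \<in> ball ?z r \<and> chart_inv c w \<notin> zero_set A \<eta>" for w
    proof (cases "w \<in> ball ?z r")
      case True
      then have "chart_inv c w \<in> zero_set A \<eta> \<longleftrightarrow> Q c w = 0"
        using r(2) in_zero_set_iff[OF c(1)] by blast
      then show ?thesis using True r(3)[of w] by (cases "w = ?z") simp_all
    qed simp
    then have "?P = {w \<in> ball ?z r. chart_inv c w \<notin> zero_set A \<eta>}" by blast
    then show ?thesis by blast
  qed
  moreover have "open ?B" by (rule open_chart_inv_image[OF c(1) open_ball r(2)])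
  moreover have "x \<in> ?B" using chart_inv_coord[OF c] r(1) by (metis centre_in_ball imageI)
  ultimately show "\<exists>B. open B \<and> x \<in> B \<and> connected (B - zero_set A \<eta>)" by metis
qed

end

section \<open>Gluing local solutions\<close>

lemma series_inner_eq_series_prod:
  assumes "k \<le> 0"
  shows "series_inner p q k x = series_prod (\<lambda>i. p (- int i)) (\<lambda>i. q (- int i)) (nat (- k)) x"
  unfolding series_inner_def series_prod_def
  by (rule sum.reindex_bij_witness[of _ "\<lambda>i. (- int i, k + int i)" "\<lambda>(i, j). nat (- i)"])
    (use assms in \<open>auto simp: algebra_simps\<close>)

context isothermic
begin

subsection \<open>Change of charts\<close>

definition transition :: "'a chart \<Rightarrow> 'a chart \<Rightarrow> complex \<Rightarrow> complex" where
  "transition c d = snd d \<circ> chart_inv c"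

lemma transition_derivative:
  assumes "c \<in> A" "d \<in> A" "z \<in> chart_image c (fst d)"
  shows "(transition c d has_derivative (*) (deriv (transition c d) z)) (at z)"
proof -
  have "transition c d holomorphic_on chart_image c (fst d)"
    using riemann assms unfolding riemann_surface_def transition_def by blast
  then have "(transition c d has_field_derivative deriv (transition c d) z) (at z)"
    using open_chart_image[OF assms(1) chart(1)[OF assms(2)]] assms(3) holomorphic_derivI by blast
  then show ?thesis by (simp add: has_field_derivative_def)
qed

lemma transition_in:
  assumes "c \<in> A" "d \<in> A" "z \<in> chart_image c (fst d)"
  shows "z \<in> coord_range c" "transition c d z \<in> coord_range d" "chart_inv d (transition c d z) = chart_inv c z"
  using assms chart_inv_coord[OF assms(2)] unfolding transition_def by (auto simp: chart_image_eq)

lemma transition_chain: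
  assumes cd: "c \<in> A" "d \<in> A" and z: "z \<in> chart_image c (fst d)"
    and f: "f differentiable (at (transition c d z))"
  shows "(f \<circ> transition c d) differentiable (at z)"
    "dirD v (f \<circ> transition c d) z = dirD (deriv (transition c d) z * v) f (transition c d z)"
proof -
  have der: "((f \<circ> transition c d) has_derivative
      ((\<lambda>v. dirD v f (transition c d z)) \<circ> (*) (deriv (transition c d) z))) (at z)"
    by (rule diff_chain_at[OF transition_derivative[OF cd z] has_derivative_dirD[OF f]])
  then show "(f \<circ> transition c d) differentiable (at z)"
    "dirD v (f \<circ> transition c d) z = dirD (deriv (transition c d) z * v) f (transition c d z)"
    using dirD_eqI[OF der, of v] der by (auto simp: differentiable_def)
qed

lemma H_transition:
  assumes cd: "c \<in> A" "d \<in> A" and z: "z \<in> chart_image c (fst d)"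
  shows "H c v z = H d (deriv (transition c d) z * v) (transition c d z)"
proof -
  let ?x = "chart_inv c z"
  have x: "?x \<in> fst c \<inter> fst d" "snd c ?x = z"
    using z cd chart_inv_in coord_chart_inv by (auto simp: chart_image_eq)
  have "\<eta> c ?x v = \<eta> d ?x (diff c (snd d) ?x v)"
    using isothermic cd x(1) unfolding isothermic_surface_def smooth_one_form_def by blast
  also have "diff c (snd d) ?x v = deriv (transition c d) z * v"
    using dirD_eqI[OF transition_derivative[OF cd z], of v]
    by (simp add: diff_def dirD_def x(2) transition_def)
  finally show ?thesis using transition_in(3)[OF cd z] by simp
qed

abbreviation normal where "normal c \<equiv> isothermic_chart.nrm (F c)"

text \<open>A holomorphic change of coordinates multiplies the two partial derivatives by a complex number \<open>a\<close>. The
  cross product and the conformal factor \<open>\<mu>\<close> are both multiplied by \<open>\<bar>a\<bar>\<^sup>2\<close>.\<close>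

lemma normal_transition:
  assumes cd: "c \<in> A" "d \<in> A" and z: "z \<in> chart_image c (fst d)"
  shows "normal c z = normal d (transition c d z)"
proof -
  let ?T = "transition c d"
  interpret C: isothermic_chart "coord_range c" "F c" "H c" by (rule isothermic_chart[OF cd(1)])
  interpret D: isothermic_chart "coord_range d" "F d" "H d" by (rule isothermic_chart[OF cd(2)])
  note zc = transition_in(1)[OF cd z] and Tz = transition_in(2)[OF cd z]
  define a where "a = deriv ?T z"
  let ?u = "fst (dirD 1 (F d) (?T z))" and ?w = "fst (dirD \<i> (F d) (?T z))"
  have Fv: "dirD v (F c) z = Re (a * v) *\<^sub>R dirD 1 (F d) (?T z) + Im (a * v) *\<^sub>R dirD \<i> (F d) (?T z)" for v
  proof -
    have "dirD v (F c) z = dirD v (F d \<circ> ?T) z"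
      by (rule dirD_cong[OF open_chart_image[OF cd(1) chart(1)[OF cd(2)]] z _ C.F_diff[OF zc]])
        (simp add: transition_in(3)[OF cd])
    also have "\<dots> = dirD (a * v) (F d) (?T z)"
      unfolding a_def by (rule transition_chain(2)[OF cd z D.F_diff[OF Tz]])
    also have "\<dots> = Re (a * v) *\<^sub>R dirD 1 (F d) (?T z) + Im (a * v) *\<^sub>R dirD \<i> (F d) (?T z)"
      by (rule D.F1_basis[OF Tz])
    finally show ?thesis .
  qed
  have F1: "dirD 1 (F c) z = Re a *\<^sub>R dirD 1 (F d) (?T z) + Im a *\<^sub>R dirD \<i> (F d) (?T z)"
    and Fi: "dirD \<i> (F c) z = Re a *\<^sub>R dirD \<i> (F d) (?T z) - Im a *\<^sub>R dirD 1 (F d) (?T z)"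
    using Fv[of 1] Fv[of \<i>] by simp_all
  let ?m = "D.\<mu> 1 (?T z)" and ?aa = "Re a * Re a + Im a * Im a"
  have mu: "C.\<mu> 1 z = ?aa * ?m"
    unfolding F1 using D.conformal[OF Tz, of 1] by (simp add: lorentz_commute algebra_simps)
  have "?aa \<noteq> 0" using mu C.conformal(1)[OF zc, of 1] by auto
  moreover have "cross4 (fst (F c z)) (fst (dirD 1 (F c) z)) (fst (dirD \<i> (F c) z))
      = ?aa *\<^sub>R cross4 (fst (F d (?T z))) ?u ?w"
    using cross4_rotate[of _ "Re a" ?u "Im a" ?w] by (simp add: F1 Fi transition_in(3)[OF cd z])
  ultimately show ?thesis unfolding C.nrm_def D.nrm_def mu by simp
qed

abbreviation conserved_in where "conserved_in c \<equiv> isothermic_chart.conserved (H c)"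

lemma conserved_transition:
  assumes cd: "c \<in> A" "d \<in> A" and S: "S \<subseteq> coord_range d" and p: "conserved_in d S p"
  shows "conserved_in c {z \<in> chart_image c (fst d). transition c d z \<in> S} (\<lambda>k. p k \<circ> transition c d)"
proof -
  interpret C: isothermic_chart "coord_range c" "F c" "H c" by (rule isothermic_chart[OF cd(1)])
  interpret D: isothermic_chart "coord_range d" "F d" "H d" by (rule isothermic_chart[OF cd(2)])
  show ?thesis
    unfolding C.conserved_def
    using D.conservedD[OF p] by (simp add: transition_chain[OF cd] H_transition[OF cd, unfolded o_def])
qed

subsection \<open>Existence\<close>

text \<open>The sign of the leading normal component is prescribed, so that local solutions are unique.\<close>

definition local_solution :: "(nat \<Rightarrow> real) \<Rightarrow> 'a chart \<Rightarrow> complex set \<Rightarrow> (nat \<Rightarrow> complex \<Rightarrow> R41) \<Rightarrow> bool" where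
  "local_solution r c S p \<longleftrightarrow> open S \<and> S \<subseteq> chart_image c (- zero_set A \<eta>) \<and> conserved_in c S p \<and>
     (\<forall>z\<in>S. (\<forall>k. series_prod p p k z = r k) \<and> lorentz (normal c z) (p 0 z) > 0)"

lemma open_Compl_zero_set: "open (- zero_set A \<eta>)"
proof (rule topological_space_class.openI)
  fix x assume x: "x \<in> - zero_set A \<eta>"
  obtain c where c: "c \<in> A" "x \<in> fst c" by (rule ex_chart)
  let ?G = "coord_range c \<inter> Q c -` (- {0})"
  have "continuous_on (coord_range c) (Q c)"
    by (intro holomorphic_on_imp_continuous_on isothermic_chart.Q_holomorphic[OF isothermic_chart[OF c(1)]])
  then have "open ?G" using chart(2)[OF c(1)] by (intro continuous_open_preimage) auto
  then have "open (chart_inv c ` ?G)" by (intro open_chart_inv_image[OF c(1)]) auto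
  moreover have "chart_inv c ` ?G \<subseteq> - zero_set A \<eta>"
    using in_zero_set_iff[OF c(1)] by auto
  moreover have "snd c x \<in> ?G"
    using x c in_zero_set_iff[OF c(1), of "snd c x"] chart_inv_coord[OF c] by auto
  then have "x \<in> chart_inv c ` ?G" using chart_inv_coord[OF c] by (metis imageI)
  ultimately show "\<exists>T. open T \<and> x \<in> T \<and> T \<subseteq> - zero_set A \<eta>" by blast
qed

lemma Q_nonzero:
  assumes c: "c \<in> A" and z: "z \<in> chart_image c (- zero_set A \<eta>)"
  shows "z \<in> coord_range c \<and> Q c z \<noteq> 0"
  using z in_zero_set_iff[OF c, of z] by (simp add: chart_image_eq[OF c])

lemma local_solution_exists:
  assumes r: "r 0 > 0" and c: "c \<in> A" and z: "z \<in> chart_image c (- zero_set A \<eta>)"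
  shows "\<exists>S p. z \<in> S \<and> local_solution r c S p \<and> (\<forall>k. smooth_on S (p k))"
proof -
  interpret C: isothermic_chart "coord_range c" "F c" "H c" by (rule isothermic_chart[OF c])
  let ?V = "chart_image c (- zero_set A \<eta>)"
  have zQ: "z \<in> coord_range c" "Q c z \<noteq> 0" using Q_nonzero[OF c z] by auto
  have V: "open ?V" by (rule open_chart_image[OF c open_Compl_zero_set])
  show ?thesis
  proof (rule C.conserved_exists[of z r, OF zQ r])
    fix S p assume S: "open S" "z \<in> S" "S \<subseteq> coord_range c" "\<And>k. smooth_on S (p k)" "conserved_in c S p"
      "\<And>k z. z \<in> S \<Longrightarrow> series_prod p p k z = r k"
      "\<And>z. z \<in> S \<Longrightarrow> lorentz (normal c z) (p 0 z) = sqrt (r 0)"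
    have "local_solution r c (S \<inter> ?V) p"
      unfolding local_solution_def
      using S V r C.conserved_subset[OF S(5), of "S \<inter> ?V"] by auto
    moreover have "smooth_on (S \<inter> ?V) (p k)" for k by (rule smooth_on_subset[OF S(4)]) simp
    ultimately show ?thesis using z S(2) by blast
  qed
qed

lemma local_solution_unique:
  assumes c: "c \<in> A" and p: "local_solution r c S p" and q: "local_solution r c T q" and z: "z \<in> S" "z \<in> T"
  shows "p k z = q k z"
proof -
  interpret C: isothermic_chart "coord_range c" "F c" "H c" by (rule isothermic_chart[OF c])
  have ST: "open (S \<inter> T)" "S \<inter> T \<subseteq> chart_image c (- zero_set A \<eta>)"
    using p q unfolding local_solution_def by auto
  show ?thesis
  proof (rule C.conserved_unique[OF ST(1)])
    show "S \<inter> T \<subseteq> coord_range c" "Q c z \<noteq> 0" using ST(2) Q_nonzero[OF c] z by blast+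
    show "conserved_in c (S \<inter> T) p" "conserved_in c (S \<inter> T) q"
      using p q C.conserved_subset unfolding local_solution_def by (meson inf_le1 inf_le2)+
    show "series_prod p p k z = series_prod q q k z" if "z \<in> S \<inter> T" for k z
      using p q that unfolding local_solution_def by auto
    show "lorentz (normal c z) (p 0 z + q 0 z) \<noteq> 0" if "z \<in> S \<inter> T" for z
    proof -
      have "lorentz (normal c z) (p 0 z) > 0" "lorentz (normal c z) (q 0 z) > 0"
        using p q that unfolding local_solution_def by auto
      then show ?thesis by simp
    qed
  qed (use z in simp)
qed

lemma local_solution_transition:
  assumes cd: "c \<in> A" "d \<in> A" and p: "local_solution r d S p"
  shows "local_solution r c {z \<in> chart_image c (fst d). transition c d z \<in> S} (\<lambda>k. p k \<circ> transition c d)"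
proof -
  let ?V = "chart_image c (fst d)"
  note p' = p[unfolded local_solution_def]
  have Sd: "S \<subseteq> coord_range d" using p' Q_nonzero[OF cd(2)] by blast
  have V: "open ?V" by (rule open_chart_image[OF cd(1) chart(1)[OF cd(2)]])
  have "continuous_on ?V (transition c d)"
    using transition_derivative[OF cd] has_derivative_continuous
    by (intro continuous_at_imp_continuous_on) blast
  then have "open (?V \<inter> transition c d -` S)"
    using p' V by (intro continuous_open_preimage) auto
  moreover have "?V \<inter> transition c d -` S = {z \<in> ?V. transition c d z \<in> S}" by auto
  moreover have "z \<in> chart_image c (- zero_set A \<eta>)" if "z \<in> ?V" "transition c d z \<in> S" for z
    using p' that transition_in[OF cd that(1)] by (auto simp: chart_image_eq cd)
  ultimately show ?thesis
    unfolding local_solution_def using p' conserved_transition[OF cd Sd]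
    by (auto simp: series_prod_def normal_transition[OF cd])
qed

text \<open>The value at \<open>x\<close> is that of any local solution near \<open>x\<close>, in any chart. Solutions in different charts agree
  by \<open>local_solution_transition\<close> and \<open>local_solution_unique\<close>, so near each point and in each chart the result is
  a single smooth local solution.\<close>

lemma global_solution:
  assumes r: "r 0 > 0"
  obtains p where "\<And>c z. c \<in> A \<Longrightarrow> z \<in> chart_image c (- zero_set A \<eta>) \<Longrightarrow>
    \<exists>S P. z \<in> S \<and> local_solution r c S P \<and> (\<forall>k. smooth_on S (P k)) \<and> (\<forall>k. \<forall>y\<in>S. p k (chart_inv c y) = P k y)"
proof -
  let ?Z = "zero_set A \<eta>"
  have "\<exists>c S P. c \<in> A \<and> x \<in> fst c \<and> snd c x \<in> S \<and> local_solution r c S P" if "x \<in> - ?Z" for x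
  proof -
    obtain c where c: "c \<in> A" "x \<in> fst c" by (rule ex_chart)
    have "snd c x \<in> chart_image c (- ?Z)" using c that by (auto simp: chart_image_def)
    from local_solution_exists[where r = r, OF r c(1) this] c show ?thesis by blast
  qed
  then obtain C S P where CSP: "\<And>x. x \<in> - ?Z \<Longrightarrow> C x \<in> A \<and> x \<in> fst (C x) \<and> snd (C x) x \<in> S x \<and>
      local_solution r (C x) (S x) (P x)" by metis
  define p where "p k x = P x k (snd (C x) x)" for k x
  show thesis
  proof (rule that[of p])
    fix c z assume c: "c \<in> A" and z: "z \<in> chart_image c (- ?Z)"
    obtain T R where T: "z \<in> T" "local_solution r c T R" "\<forall>k. smooth_on T (R k)"
      using local_solution_exists[where r = r, OF r c z] by blast
    have "p k (chart_inv c y) = R k y" if y: "y \<in> T" for k y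
    proof -
      let ?x = "chart_inv c y"
      have yV: "y \<in> coord_range c" "?x \<in> - ?Z"
        using T(2) y c unfolding local_solution_def by (auto simp: chart_image_eq)
      let ?d = "C ?x"
      have d: "?d \<in> A" "?x \<in> fst ?d" "snd ?d ?x \<in> S ?x" "local_solution r ?d (S ?x) (P ?x)"
        using CSP[OF yV(2)] by auto
      let ?S' = "{z \<in> chart_image c (fst ?d). transition c ?d z \<in> S ?x}"
      have "y \<in> ?S'" using d yV c by (simp add: chart_image_eq transition_def)
      then have "(P ?x k \<circ> transition c ?d) y = R k y"
        by (intro local_solution_unique[OF c local_solution_transition[OF c d(1,4)] T(2) _ y])
      then show ?thesis by (simp add: p_def transition_def)
    qed
    then show "\<exists>S P. z \<in> S \<and> local_solution r c S P \<and> (\<forall>k. smooth_on S (P k)) \<and>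
        (\<forall>k. \<forall>y\<in>S. p k (chart_inv c y) = P k y)" using T by blast
  qed
qed

lemma diff_eq_dirD:
  "c \<in> A \<Longrightarrow> z \<in> coord_range c \<Longrightarrow> diff c f (chart_inv c z) v = dirD v (f \<circ> chart_inv c) z"
  by (simp add: diff_def dirD_def coord_chart_inv)

lemma ex_outside_zero_set: obtains x where "x \<in> - zero_set A \<eta>"
  using zero_set_interior_empty[OF open_UNIV] by auto

lemma formal_conserved_quantityI:
  assumes r: "r 0 > 0"
    and p: "\<And>c z. c \<in> A \<Longrightarrow> z \<in> chart_image c (- zero_set A \<eta>) \<Longrightarrow>
      \<exists>S P. z \<in> S \<and> local_solution r c S P \<and> (\<forall>k. smooth_on S (P k)) \<and>
        (\<forall>k. \<forall>y\<in>S. p k (chart_inv c y) = P k y)"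
  shows "formal_conserved_quantity A \<eta> (- zero_set A \<eta>) (\<lambda>i. p (nat (- i)))"
    "x \<in> - zero_set A \<eta> \<Longrightarrow> series_prod p p k x = r k"
proof -
  let ?V = "- zero_set A \<eta>"
  have local_eq: "smooth_on S (p k \<circ> chart_inv c)" "dirD v (p k \<circ> chart_inv c) y = dirD v (P k) y"
    if "c \<in> A" "open S" "smooth_on S (P k)" "\<forall>y\<in>S. p k (chart_inv c y) = P k y" "y \<in> S"
    for c S k y v and P :: "nat \<Rightarrow> complex \<Rightarrow> R41"
  proof -
    show "smooth_on S (p k \<circ> chart_inv c)"
      by (rule smooth_on_cong[OF that(2,3)]) (simp add: that(4))
    then show "dirD v (p k \<circ> chart_inv c) y = dirD v (P k) y"
      by (intro dirD_cong[OF that(2,5)] smooth_on_differentiable[OF _ that(5)]) (simp_all add: that(4))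
  qed
  have pt: "\<exists>z. x = chart_inv c z \<and> z \<in> coord_range c \<and> z \<in> chart_image c ?V"
    if "c \<in> A" "x \<in> ?V \<inter> fst c" for c x
    using that chart_inv_coord[OF that(1), of x] by (intro exI[of _ "snd c x"]) (auto simp: chart_image_def)
  have smooth: "smooth_fun_on A ?V (p k)" for k
    unfolding smooth_fun_on_def
  proof (intro ballI smooth_on_local)
    fix c z assume c: "c \<in> A" and z: "z \<in> chart_image c ?V"
    obtain S P where S: "z \<in> S" "local_solution r c S P" "\<forall>k. smooth_on S (P k)"
      "\<forall>k. \<forall>y\<in>S. p k (chart_inv c y) = P k y" using p[OF c z] by blast
    then have "open S" "smooth_on S (p k \<circ> chart_inv c)"
      using local_eq(1)[OF c] unfolding local_solution_def by blast+
    then show "\<exists>T. open T \<and> z \<in> T \<and> smooth_on T (p k \<circ> chart_inv c)" using S(1) by blast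
  qed
  have eqs: "blinfun_apply (\<eta> c x v) (p 0 x) = 0 \<and>
      diff c (p k) x v + blinfun_apply (\<eta> c x v) (p (Suc k) x) = 0 \<and>
      series_prod p p k x = r k \<and> p 0 x \<noteq> 0"
    if c: "c \<in> A" and x: "x \<in> ?V \<inter> fst c" for c x v k
  proof -
    interpret C: isothermic_chart "coord_range c" "F c" "H c" by (rule isothermic_chart[OF c])
    obtain z where z: "x = chart_inv c z" "z \<in> coord_range c" "z \<in> chart_image c ?V"
      using pt[OF c x] by blast
    obtain S P where S: "z \<in> S" "local_solution r c S P" "\<forall>k. smooth_on S (P k)"
      "\<forall>k. \<forall>y\<in>S. p k (chart_inv c y) = P k y" using p[OF c z(3)] by blast
    note P = S(2)[unfolded local_solution_def]
    have px: "p k x = P k z" for k using S(1,4) z(1) by simp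
    have "C.conserved S P" using P by blast
    note D = C.conservedD[OF this S(1)]
    have "diff c (p k) x v = dirD v (P k) z"
      unfolding z(1) diff_eq_dirD[OF c z(2)]
      using P S(3,4) by (intro local_eq(2)[OF c _ _ _ S(1)]) auto
    moreover have "P 0 z \<noteq> 0" using P S(1) by force
    moreover have "series_prod p p k x = series_prod P P k z" by (simp add: series_prod_def px)
    ultimately show ?thesis using D(2)[of v] D(3)[of v k] P S(1) by (simp add: px z(1)[symmetric])
  qed
  show "series_prod p p k x = r k" if "x \<in> ?V"
    using eqs that ex_chart[of x] by (metis IntI)
  obtain x where x: "x \<in> ?V" by (rule ex_outside_zero_set)
  then have nz: "\<exists>x\<in>?V. p 0 x \<noteq> 0" using eqs ex_chart[of x] by (metis IntI)
  show "formal_conserved_quantity A \<eta> ?V (\<lambda>i. p (nat (- i)))"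
    unfolding formal_conserved_quantity_def
  proof (intro conjI allI impI ballI)
    fix i :: int and c x v assume i: "i \<le> 0" and c: "c \<in> A" and x: "x \<in> ?V \<inter> fst c"
    have "nat (- (i - 1)) = Suc (nat (- i))" using i by simp
    then show "diff c (p (nat (- i))) x v + blinfun_apply (\<eta> c x v) (p (nat (- (i - 1))) x) = 0"
      using eqs[OF c x, of v "nat (- i)"] by simp
  qed (use open_Compl_zero_set smooth nz eqs in auto)
qed

subsection \<open>Uniqueness\<close>

lemma conserved_in_chart:
  assumes q: "formal_conserved_quantity A \<eta> (- zero_set A \<eta>) q" and c: "c \<in> A"
  shows "conserved_in c (chart_image c (- zero_set A \<eta>)) (\<lambda>k. q (- int k) \<circ> chart_inv c)"
proof -
  interpret C: isothermic_chart "coord_range c" "F c" "H c" by (rule isothermic_chart[OF c])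
  let ?V = "- zero_set A \<eta>"
  note q' = q[unfolded formal_conserved_quantity_def]
  show ?thesis
    unfolding C.conserved_def
  proof (intro conjI allI ballI)
    fix k z assume z: "z \<in> chart_image c ?V"
    have "smooth_on (chart_image c ?V) (q (- int k) \<circ> chart_inv c)"
      using q' c unfolding smooth_fun_on_def by simp
    from smooth_on_differentiable[OF this z]
    show "(q (- int k) \<circ> chart_inv c) differentiable (at z)" .
    fix v
    have zc: "z \<in> coord_range c" and x: "chart_inv c z \<in> ?V \<inter> fst c"
      using z c chart_inv_in by (auto simp: chart_image_eq)
    show "blinfun_apply (H c v z) ((q (- int 0) \<circ> chart_inv c) z) = 0"
      using q' c x by simp
    have "diff c (q (- int k)) (chart_inv c z) v
        + blinfun_apply (\<eta> c (chart_inv c z) v) (q (- int k - 1) (chart_inv c z)) = 0"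
      using q' c x by simp
    moreover have "- int (Suc k) = - int k - 1" by simp
    ultimately show "dirD v (q (- int k) \<circ> chart_inv c) z
        + blinfun_apply (H c v z) ((q (- int (Suc k)) \<circ> chart_inv c) z) = 0"
      unfolding diff_eq_dirD[OF c zc] by (simp only: o_apply)
  qed
qed

text \<open>The normal components \<open>g p\<close> and \<open>g q\<close> of the leading coefficients have square \<open>r 0 > 0\<close>. So the sign \<open>e\<close> of their
  product is constant near \<open>x\<close>, and there \<open>q\<close> and \<open>e p\<close> have leading normal components of the same sign.\<close>

lemma unique_up_to_sign_locally:
  assumes r: "r 0 > 0"
    and p: "formal_conserved_quantity A \<eta> (- zero_set A \<eta>) p"
      "\<And>k x. x \<in> - zero_set A \<eta> \<Longrightarrow> series_prod (\<lambda>k. p (- int k)) (\<lambda>k. p (- int k)) k x = r k"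
    and q: "formal_conserved_quantity A \<eta> (- zero_set A \<eta>) q"
      "\<And>k x. x \<in> - zero_set A \<eta> \<Longrightarrow> series_prod (\<lambda>k. q (- int k)) (\<lambda>k. q (- int k)) k x = r k"
    and x: "x \<in> - zero_set A \<eta>"
  shows "\<exists>B e. open B \<and> x \<in> B \<and> (e = 1 \<or> e = -1) \<and>
    (\<forall>y\<in>B. \<forall>k. q (- int k) y = e *\<^sub>R p (- int k) y)"
proof -
  let ?V = "- zero_set A \<eta>"
  obtain c where c: "c \<in> A" "x \<in> fst c" by (rule ex_chart)
  interpret C: isothermic_chart "coord_range c" "F c" "H c" by (rule isothermic_chart[OF c(1)])
  let ?S = "chart_image c ?V"
  let ?in = "\<lambda>p k. p (- int k) \<circ> chart_inv c"
  define g where "g p z = lorentz (normal c z) (p 0 (chart_inv c z))" for p :: "int \<Rightarrow> 'a \<Rightarrow> R41" and z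
  have S: "open ?S" "?S \<subseteq> coord_range c"
    using open_chart_image[OF c(1) open_Compl_zero_set] by (auto simp: chart_image_eq c)
  have norm: "series_prod (?in p) (?in p) k z = r k" "series_prod (?in q) (?in q) k z = r k" if "z \<in> ?S" for k z
    using p(2)[of "chart_inv c z" k] q(2)[of "chart_inv c z" k] that
    by (simp_all add: chart_image_eq c series_prod_def)
  have cons: "C.conserved ?S (?in p)" "C.conserved ?S (?in q)"
    using conserved_in_chart[OF _ c(1)] p(1) q(1) by blast+
  have Q: "C.Q z \<noteq> 0" if "z \<in> ?S" for z using Q_nonzero[OF c(1) that] by blast
  have sq: "(g p z)\<^sup>2 = r 0" "(g q z)\<^sup>2 = r 0" if z: "z \<in> ?S" for z
    using C.conserved_leading_term[OF S z Q[OF z] cons(1)] C.conserved_leading_term[OF S z Q[OF z] cons(2)]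
      norm[OF z, of 0] by (simp_all add: g_def series_prod_def)
  have cont: "continuous_on ?S (g p)" "continuous_on ?S (g q)"
  proof -
    have sm: "smooth_on ?S (p 0 \<circ> chart_inv c)" "smooth_on ?S (q 0 \<circ> chart_inv c)"
      using p(1) q(1) c(1) unfolding formal_conserved_quantity_def smooth_fun_on_def by blast+
    show "continuous_on ?S (g p)" "continuous_on ?S (g q)"
      using smooth_on_continuous[OF smooth_on_lorentz[OF S(1) smooth_on_subset[OF C.smooth_nrm S(2)] sm(1)]]
        smooth_on_continuous[OF smooth_on_lorentz[OF S(1) smooth_on_subset[OF C.smooth_nrm S(2)] sm(2)]]
      by (simp_all add: g_def[abs_def])
  qed
  let ?z = "snd c x"
  have z: "?z \<in> ?S" using c x by (auto simp: chart_image_def)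
  define e where "e = sgn (g p ?z * g q ?z)"
  have "g p ?z * g q ?z \<noteq> 0" using sq[OF z] r by auto
  then have e: "e = 1 \<or> e = -1" "e * (g p ?z * g q ?z) > 0"
    by (auto simp: e_def sgn_if zero_less_mult_iff mult_less_0_iff)
  define T where "T = ?S \<inter> (\<lambda>z. e * (g p z * g q z)) -` {0<..}"
  have T: "open T" "T \<subseteq> ?S"
    unfolding T_def by (intro continuous_open_preimage continuous_intros cont S) auto
  have cons_e: "C.conserved T (\<lambda>k z. e *\<^sub>R ?in p k z)"
    unfolding C.conserved_def
  proof (intro conjI allI ballI)
    fix k z v assume "z \<in> T"
    then have z: "z \<in> ?S" using T by blast
    note D = C.conservedD[OF cons(1) z]
    have der: "((\<lambda>z. e *\<^sub>R ?in p k z) has_derivative (\<lambda>v. e *\<^sub>R dirD v (?in p k) z)) (at z)"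
      by (intro has_derivative_scaleR_right has_derivative_dirD D(1))
    show "(\<lambda>z. e *\<^sub>R ?in p k z) differentiable (at z)"
      using der by (auto simp: differentiable_def)
    show "blinfun_apply (H c v z) (e *\<^sub>R ?in p 0 z) = 0" using D(2)[of v] by (simp add: blinfun.scaleR_right)
    have "dirD v (\<lambda>z. e *\<^sub>R ?in p k z) z + blinfun_apply (H c v z) (e *\<^sub>R ?in p (Suc k) z)
        = e *\<^sub>R (dirD v (?in p k) z + blinfun_apply (H c v z) (?in p (Suc k) z))"
      using dirD_eqI[OF der, of v] by (simp add: blinfun.scaleR_right scaleR_add_right del: o_apply)
    then show "dirD v (\<lambda>z. e *\<^sub>R ?in p k z) z + blinfun_apply (H c v z) (e *\<^sub>R ?in p (Suc k) z) = 0"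
      using D(3)[of v k] by simp
  qed
  have eq: "?in q k y = e *\<^sub>R ?in p k y" if y: "y \<in> T" for k y
  proof (rule C.conserved_unique[OF T(1) _ y _ _ cons_e])
    show "T \<subseteq> coord_range c" "C.Q y \<noteq> 0" using T(2) S(2) Q y by blast+
    show "C.conserved T (?in q)" using cons(2) T(2) by (rule C.conserved_subset)
    show "series_prod (?in q) (?in q) k z = series_prod (\<lambda>k z. e *\<^sub>R ?in p k z) (\<lambda>k z. e *\<^sub>R ?in p k z) k z"
      if "z \<in> T" for k z
    proof -
      have "e * e = 1" using e(1) by auto
      then have "series_prod (\<lambda>k z. e *\<^sub>R ?in p k z) (\<lambda>k z. e *\<^sub>R ?in p k z) k z = series_prod (?in p) (?in p) k z"
        by (simp add: series_prod_def mult.assoc[symmetric])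
      then show ?thesis using norm[of z k] that T(2) by auto
    qed
    show "lorentz (C.nrm z) (?in q 0 z + e *\<^sub>R ?in p 0 z) \<noteq> 0" if "z \<in> T" for z
    proof
      assume "lorentz (C.nrm z) (?in q 0 z + e *\<^sub>R ?in p 0 z) = 0"
      then have "g q z = - (e * g p z)" by (simp add: g_def)
      then have "e * (g p z * g q z) = - (e * g p z)\<^sup>2" by (simp add: power2_eq_square)
      moreover have "e * (g p z * g q z) > 0" using that by (simp add: T_def)
      ultimately show False by (metis neg_0_less_iff_less not_less zero_le_power2)
    qed
  qed
  let ?B = "chart_inv c ` T"
  have "open ?B" using T S by (intro open_chart_inv_image[OF c(1)]) auto
  moreover have "?z \<in> T" using z e(2) by (simp add: T_def)
  then have "x \<in> ?B" using chart_inv_coord[OF c] by (metis imageI)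
  moreover have "\<forall>y\<in>?B. \<forall>k. q (- int k) y = e *\<^sub>R p (- int k) y" using eq by auto
  ultimately show ?thesis using e(1) by blast
qed

lemma unique_up_to_sign:
  assumes r: "r 0 > 0"
    and p: "formal_conserved_quantity A \<eta> (- zero_set A \<eta>) p"
      "\<And>k x. x \<in> - zero_set A \<eta> \<Longrightarrow> series_prod (\<lambda>k. p (- int k)) (\<lambda>k. p (- int k)) k x = r k"
    and q: "formal_conserved_quantity A \<eta> (- zero_set A \<eta>) q"
      "\<And>k x. x \<in> - zero_set A \<eta> \<Longrightarrow> series_prod (\<lambda>k. q (- int k)) (\<lambda>k. q (- int k)) k x = r k"
  shows "(\<forall>k. \<forall>x\<in>- zero_set A \<eta>. q (- int k) x = p (- int k) x) \<or>
    (\<forall>k. \<forall>x\<in>- zero_set A \<eta>. q (- int k) x = - p (- int k) x)"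
proof -
  let ?V = "- zero_set A \<eta>"
  define M where "M e = \<Union>{B. open B \<and> (\<forall>y\<in>B. \<forall>k. q (- int k) y = e *\<^sub>R p (- int k) y)}" for e :: real
  have M: "open (M e)" for e unfolding M_def by blast
  have eqM: "q (- int k) y = e *\<^sub>R p (- int k) y" if "y \<in> M e" for e k y
    using that unfolding M_def by blast
  have cover: "?V \<subseteq> M 1 \<union> M (-1)"
  proof
    fix x assume x: "x \<in> ?V"
    obtain B e where "open B" "x \<in> B" "e = 1 \<or> e = - 1"
      "\<forall>y\<in>B. \<forall>k. q (- int k) y = e *\<^sub>R p (- int k) y"
      using unique_up_to_sign_locally[where r = r, OF r p q x] by blast
    then have "x \<in> M e" unfolding M_def by blast
    then show "x \<in> M 1 \<union> M (-1)" using \<open>e = 1 \<or> e = - 1\<close> by blast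
  qed
  have "M 1 \<inter> M (-1) \<inter> ?V = {}"
  proof -
    have False if "y \<in> M 1" "y \<in> M (-1)" "y \<in> ?V" for y
    proof -
      have "(1 - (-1)) *\<^sub>R p (- int 0) y = 0"
        unfolding scaleR_left_diff_distrib using eqM[OF that(1), of 0] eqM[OF that(2), of 0]
        by (metis right_minus_eq)
      then have "p 0 y = 0" by simp
      then show False using p(2)[OF that(3), of 0] r by (simp add: series_prod_def)
    qed
    then show ?thesis by blast
  qed
  then have "M 1 \<inter> ?V = {} \<or> M (-1) \<inter> ?V = {}"
    using connectedD[OF connected_minus_zero_set M M _ cover] by blast
  then have "?V \<subseteq> M (-1) \<or> ?V \<subseteq> M 1" using cover by blast
  then show ?thesis
  proof
    assume "?V \<subseteq> M (-1)"
    then have "q (- int k) x = - p (- int k) x" if "x \<in> ?V" for k x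
      using eqM[of x "-1" k] that by auto
    then show ?thesis by blast
  next
    assume "?V \<subseteq> M 1"
    then have "q (- int k) x = p (- int k) x" if "x \<in> ?V" for k x
      using eqM[of x 1 k] that by auto
    then show ?thesis by blast
  qed
qed

end

theorem theorem2p7:
  fixes A :: "('a::t2_space) chart set"
    and \<Lambda> :: "'a \<Rightarrow> R41 set"
    and \<eta> :: "('a, R41 \<Rightarrow>\<^sub>L R41) form1"
    and Z :: "'a set"
    and r :: "int \<Rightarrow> real"
  assumes "riemann_surface A"
    and "isothermic_surface A \<Lambda> \<eta>"
    and "Z = zero_set A \<eta>"
    and "r 0 > 0"
  shows "\<exists>p. formal_conserved_quantity A \<eta> (- Z) p \<and>
           (\<forall>k\<le>0. \<forall>x\<in>- Z. series_inner p p k x = r k) \<and>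
           (\<forall>q. formal_conserved_quantity A \<eta> (- Z) q \<and>
                (\<forall>k\<le>0. \<forall>x\<in>- Z. series_inner q q k x = r k) \<longrightarrow>
                (\<forall>i\<le>0. \<forall>x\<in>- Z. q i x = p i x) \<or>
                (\<forall>i\<le>0. \<forall>x\<in>- Z. q i x = - p i x))"
proof -
  interpret isothermic A \<Lambda> \<eta> using assms(1,2) by (rule isothermic.intro)
  define s where "s k = r (- int k)" for k
  have s: "s 0 > 0" using assms(4) by (simp add: s_def)
  note Z = assms(3)
  have prod_iff: "(\<forall>k\<le>0. \<forall>x\<in>- Z. series_inner q q k x = r k) \<longleftrightarrow>
      (\<forall>k. \<forall>x\<in>- Z. series_prod (\<lambda>k. q (- int k)) (\<lambda>k. q (- int k)) k x = s k)" for q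
  proof
    assume *: "\<forall>k\<le>0. \<forall>x\<in>- Z. series_inner q q k x = r k"
    show "\<forall>k. \<forall>x\<in>- Z. series_prod (\<lambda>k. q (- int k)) (\<lambda>k. q (- int k)) k x = s k"
    proof (intro allI ballI)
      fix k x assume "x \<in> - Z"
      then have "series_inner q q (- int k) x = s k" using * by (simp add: s_def)
      then show "series_prod (\<lambda>k. q (- int k)) (\<lambda>k. q (- int k)) k x = s k"
        by (simp add: series_inner_eq_series_prod)
    qed
  next
    assume "\<forall>k. \<forall>x\<in>- Z. series_prod (\<lambda>k. q (- int k)) (\<lambda>k. q (- int k)) k x = s k"
    then show "\<forall>k\<le>0. \<forall>x\<in>- Z. series_inner q q k x = r k"
      by (simp add: series_inner_eq_series_prod s_def)
  qed
  have all_iff: "(\<forall>i\<le>0. P i) \<longleftrightarrow> (\<forall>k. P (- int k))" for P :: "int \<Rightarrow> bool"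
  proof
    assume *: "\<forall>k. P (- int k)"
    have "P i" if "i \<le> 0" for i using *[rule_format, of "nat (- i)"] that by simp
    then show "\<forall>i\<le>0. P i" by blast
  qed simp
  show ?thesis
  proof (rule global_solution[of s, OF s])
    fix p0 assume p0: "\<And>c z. c \<in> A \<Longrightarrow> z \<in> chart_image c (- zero_set A \<eta>) \<Longrightarrow>
      \<exists>S P. z \<in> S \<and> local_solution s c S P \<and> (\<forall>k. smooth_on S (P k)) \<and>
        (\<forall>k. \<forall>y\<in>S. p0 k (chart_inv c y) = P k y)"
    define p where "p i = p0 (nat (- i))" for i
    have p: "formal_conserved_quantity A \<eta> (- Z) p"
      unfolding p_def[abs_def] Z by (rule formal_conserved_quantityI(1)[of s, OF s p0])
    have pn: "\<forall>k. \<forall>x\<in>- Z. series_prod (\<lambda>k. p (- int k)) (\<lambda>k. p (- int k)) k x = s k"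
      unfolding p_def nat_int minus_minus Z using formal_conserved_quantityI(2)[of s, OF s p0] by blast
    show ?thesis
      unfolding prod_iff unfolding all_iff
    proof (intro exI[of _ p] conjI allI impI)
      fix q assume q: "formal_conserved_quantity A \<eta> (- Z) q \<and>
        (\<forall>k. \<forall>x\<in>- Z. series_prod (\<lambda>k. q (- int k)) (\<lambda>k. q (- int k)) k x = s k)"
      show "(\<forall>k. \<forall>x\<in>- Z. q (- int k) x = p (- int k) x) \<or> (\<forall>k. \<forall>x\<in>- Z. q (- int k) x = - p (- int k) x)"
        unfolding Z by (rule unique_up_to_sign[where r = s, OF s]) (use p pn q Z in blast)+
    qed (use p pn in blast)+
  qed
qed

end
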